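(* Let $h_0\in(0,\infty]$, $\alpha>0$, let $u_0:\mathbb R\times[0,h_0]\to\mathbb R$ be bounded and continuous, and let $u=u(x,y,t)$ be the solution of $$\partial_tu-\tfrac12\partial_y^2u=0\ \text{ for }t>0,\ y\in(0,h_0);\qquad \alpha\,\partial_yu+\partial_x^2u=\partial_y^2u\ \text{ when }y=0;$$ $$\partial_yu=0\ \text{ when }y=h_0;\qquad u=u_0\ \text{ when }t=0.$$ Let $v(x,t)=u(x,0,t)$. Then $v$ satisfies $$\partial_tv+\frac\alpha2\,\partial_t^wv-\frac12\,\partial_x^2v=\frac\alpha2\,f,$$ with initial data $v(x,0)=u_0(x,0)$. Here $\partial_t^w$ is the generalized Caputo derivative $$\partial_t^wv(x,t)=\int_0^tw(t-s)\,\partial_tv(x,s)\,ds,\qquad w(t)=\frac2{h_0}\sum_{k=0}^\infty\exp\Big(-\frac{(2k+1)^2\pi^2t}{8h_0^2}\Big),$$ and the function $f$ is explicitly determined in terms of $u_0$ by $f=f(x,t)=\partial_yg(x,0,t)$, where $g=g(x,y,t)$ solves $$\partial_tg-\tfrac12\partial_y^2g=0\ \text{ for }t>0,\ y\in(0,h_0);\qquad g(x,0,t)=g(x,h_0,t)=0\ \text{ for }t>0;$$ $$g(x,y,0)=u_0(x,y)-u_0(x,0)\ \text{ for }y\in(0,h_0),\ t=0.$$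
   Context: When $h_0=\infty$ the function $w$ is understood as $w(t)=\left(\frac{2}{\pi t}\right)^{1/2}$ (the limit $h_0\to\infty$ of the displayed formula), $[0,h_0]$ is read as $[0,\infty)$, and the boundary conditions at $y=h_0$ are absent. In the integral defining $\partial_t^w v$, $\partial_tv(x,s)$ denotes the time derivative of $v$ evaluated at $(x,s)$.
   Formalization: For finite h_0, g satisfies ∂_y g(x,h_0,t)=0 instead of the printed g(x,h_0,t)=0, for which the equation for v fails; u and g are read as bounded classical solutions, continuous down to t=0, with derivatives in t and y continuous up to the ends of [0,h_0] for t>0. *)

theory Defs
  imports "HOL-Analysis.Analysis"
begin

text \<open>
  Functions of \<open>(x, y, t)\<close> are curried, \<open>u x y t\<close>. The length \<open>h\<close> is an extended real, so that
  \<open>h = \<infinity>\<close> gives \<open>tooth h = {0..}\<close>.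
\<close>

definition tooth :: "ereal \<Rightarrow> real set" where
  "tooth h = {y. 0 \<le> y \<and> ereal y \<le> h}"

definition dt :: "(real \<Rightarrow> real \<Rightarrow> real \<Rightarrow> real) \<Rightarrow> real \<Rightarrow> real \<Rightarrow> real \<Rightarrow> real" where
  "dt u x y t = deriv (\<lambda>s. u x y s) t"

text \<open>Relative to \<open>tooth h\<close>: a two-sided derivative inside, a one-sided one at the end points.\<close>

definition dy :: "ereal \<Rightarrow> (real \<Rightarrow> real \<Rightarrow> real \<Rightarrow> real) \<Rightarrow> real \<Rightarrow> real \<Rightarrow> real \<Rightarrow> real" where
  "dy h u x y t = vector_derivative (\<lambda>\<eta>. u x \<eta> t) (at y within tooth h)"

definition dyy :: "ereal \<Rightarrow> (real \<Rightarrow> real \<Rightarrow> real \<Rightarrow> real) \<Rightarrow> real \<Rightarrow> real \<Rightarrow> real \<Rightarrow> real" where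
  "dyy h u = dy h (dy h u)"

definition twice_differentiable_at :: "(real \<Rightarrow> real) \<Rightarrow> real \<Rightarrow> bool" where
  "twice_differentiable_at \<phi> x \<longleftrightarrow>
     (\<forall>\<^sub>F z in nhds x. \<phi> differentiable at z) \<and> deriv \<phi> differentiable at x"

text \<open>
  The regularity of a bounded classical solution: bounded and continuous down to \<open>t = 0\<close>, and
  for \<open>t > 0\<close> differentiable up to the ends of the tooth. Only the tooth direction is
  diffusive off the spine, so \<open>x\<close> is a parameter there and no \<open>x\<close>-derivative is asked for.
  Boundedness selects the solution when \<open>h = \<infinity>\<close>, where the Cauchy--Dirichlet problem
  otherwise has many solutions.
\<close>

definition bounded_classical :: "ereal \<Rightarrow> (real \<Rightarrow> real \<Rightarrow> real \<Rightarrow> real) \<Rightarrow> bool" where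
  "bounded_classical h u \<longleftrightarrow>
     bounded ((\<lambda>(x, y, t). u x y t) ` (UNIV \<times> tooth h \<times> {0..})) \<and>
     continuous_on (UNIV \<times> tooth h \<times> {0..}) (\<lambda>(x, y, t). u x y t) \<and>
     (\<forall>x. \<forall>y\<in>tooth h. \<forall>t>0.
        (\<lambda>s. u x y s) differentiable at t \<and>
        (\<lambda>\<eta>. u x \<eta> t) differentiable (at y within tooth h) \<and>
        (\<lambda>\<eta>. dy h u x \<eta> t) differentiable (at y within tooth h)) \<and>
     (\<forall>x. continuous_on (tooth h \<times> {0<..}) (\<lambda>(y, t). dt u x y t) \<and>
          continuous_on (tooth h \<times> {0<..}) (\<lambda>(y, t). dy h u x y t) \<and>
          continuous_on (tooth h \<times> {0<..}) (\<lambda>(y, t). dyy h u x y t))"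

definition comb_solution ::
  "ereal \<Rightarrow> real \<Rightarrow> (real \<Rightarrow> real \<Rightarrow> real) \<Rightarrow> (real \<Rightarrow> real \<Rightarrow> real \<Rightarrow> real) \<Rightarrow> bool" where
  "comb_solution h \<alpha> u0 u \<longleftrightarrow>
     bounded_classical h u \<and>
     (\<forall>x y t. t > 0 \<longrightarrow> 0 < y \<longrightarrow> ereal y < h \<longrightarrow> dt u x y t - 1/2 * dyy h u x y t = 0) \<and>
     (\<forall>x t. t > 0 \<longrightarrow>
        twice_differentiable_at (\<lambda>z. u z 0 t) x \<and>
        \<alpha> * dy h u x 0 t + deriv (deriv (\<lambda>z. u z 0 t)) x = dyy h u x 0 t) \<and>
     (h \<noteq> \<infinity> \<longrightarrow> (\<forall>x t. t > 0 \<longrightarrow> dy h u x (real_of_ereal h) t = 0)) \<and>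
     (\<forall>x. \<forall>y\<in>tooth h. u x y 0 = u0 x y)"

text \<open>
  The condition at \<open>y = h\<close> is the same no-flux condition as for \<open>u\<close>, not \<open>g x h t = 0\<close>: the
  exponents \<open>(2k+1)\<^sup>2\<pi>\<^sup>2/(8h\<^sup>2)\<close> in the kernel below belong to the problem that is Dirichlet
  at \<open>0\<close> and Neumann at \<open>h\<close>. With \<open>g x h t = 0\<close> the equation for \<open>v\<close> fails for finite \<open>h\<close>.
\<close>

definition tooth_solution ::
  "ereal \<Rightarrow> (real \<Rightarrow> real \<Rightarrow> real) \<Rightarrow> (real \<Rightarrow> real \<Rightarrow> real \<Rightarrow> real) \<Rightarrow> bool" where
  "tooth_solution h u0 g \<longleftrightarrow>
     bounded_classical h g \<and>
     (\<forall>x y t. t > 0 \<longrightarrow> 0 < y \<longrightarrow> ereal y < h \<longrightarrow> dt g x y t - 1/2 * dyy h g x y t = 0) \<and>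
     (\<forall>x t. t > 0 \<longrightarrow> g x 0 t = 0) \<and>
     (h \<noteq> \<infinity> \<longrightarrow> (\<forall>x t. t > 0 \<longrightarrow> dy h g x (real_of_ereal h) t = 0)) \<and>
     (\<forall>x y. 0 < y \<longrightarrow> ereal y < h \<longrightarrow> g x y 0 = u0 x y - u0 x 0)"

definition caputo_kernel :: "ereal \<Rightarrow> real \<Rightarrow> real" where
  "caputo_kernel h t =
     (if h = \<infinity> then sqrt (2 / (pi * t))
      else 2 / real_of_ereal h *
        (\<Sum>k. exp (- ((2 * real k + 1)\<^sup>2 * pi\<^sup>2 * t / (8 * (real_of_ereal h)\<^sup>2)))))"

text \<open>
  The integral is a Henstock--Kurzweil integral. For initial data that are merely continuous,
  \<open>\<partial>\<^sub>t v\<close> need not be absolutely integrable near \<open>s = 0\<close>, and the integral is then improper.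
  The values of the integrand at the end points are irrelevant.
\<close>

definition caputo_integrand ::
  "ereal \<Rightarrow> (real \<Rightarrow> real \<Rightarrow> real) \<Rightarrow> real \<Rightarrow> real \<Rightarrow> real \<Rightarrow> real" where
  "caputo_integrand h v x t s = caputo_kernel h (t - s) * deriv (\<lambda>r. v x r) s"

definition caputo_deriv :: "ereal \<Rightarrow> (real \<Rightarrow> real \<Rightarrow> real) \<Rightarrow> real \<Rightarrow> real \<Rightarrow> real" where
  "caputo_deriv h v x t = integral {0..t} (caputo_integrand h v x t)"

end

theory Submission
  imports Defs "HOL-Probability.Distributions"
begin

text \<open>
  On the spine the heat equation, extended to \<open>y = 0\<close> by continuity, turns the coupling condition into
  \<open>\<partial>\<^sub>t v - \<partial>\<^sub>x\<^sup>2 v / 2 = \<alpha> / 2 * \<partial>\<^sub>y u\<close>. So everything rests on expressing the flux \<open>\<partial>\<^sub>y u\<close> through the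
  history of \<open>v\<close>. Fix \<open>x\<close> and put \<open>\<phi> = u - g - u0 x 0\<close>: it solves the heat equation in the tooth, has
  zero initial data and no flux through the far end, and its trace at \<open>y = 0\<close> is \<open>v - u0 x 0\<close>. The
  claim becomes \<open>\<partial>\<^sub>y \<phi> (0, t) = - \<integral>\<^sub>0\<^sup>t w (t - s) \<partial>\<^sub>s \<phi> (0, s) ds\<close>, which is the lemma \<open>flux_identity\<close>.

  The idea is duality. Let \<open>K (y, \<tau>)\<close> be the heat kernel with source at \<open>y = 0\<close>, Neumann condition at
  \<open>0\<close> and Dirichlet condition at the far end, so that \<open>K (0, \<tau>) = w \<tau>\<close>. The function
  \<open>F s = \<integral> \<partial>\<^sub>y \<phi> (y, s) K (y, t - s) dy\<close> has the derivative \<open>- w (t - s) \<partial>\<^sub>s \<phi> (0, s)\<close> by Green's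
  identity, vanishes at \<open>s = 0\<close> because of the zero initial data, and tends to \<open>\<partial>\<^sub>y \<phi> (0, t)\<close> as \<open>s\<close>
  tends to \<open>t\<close> because \<open>K\<close> concentrates at \<open>0\<close>. The fundamental theorem of calculus then yields both
  the existence of the improper integral and its value. The proofs work with the form
  \<open>F s = - \<integral> \<phi> (y, s) \<partial>\<^sub>y K (y, t - s) dy - w (t - s) \<phi> (0, s)\<close> obtained by integration by parts,
  because it makes sense down to \<open>s = 0\<close> and is controlled by the bound on \<open>\<phi>\<close> alone.

  In both cases \<open>F\<close> is a uniform limit of simpler pairings \<open>F\<^sub>N\<close>, whose derivatives converge locally
  uniformly on the open interval (\<open>has_integral_of_locally_uniform_derivatives\<close>). For a bounded tooth
  these are the partial sums of the expansion of \<open>K\<close> into modes; near \<open>s = t\<close> the uniformity comes from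
  Bessel's inequality (\<open>bessel_inequality\<close>), and the limit value from the convergence of a cosine series
  at \<open>0\<close> (\<open>cosine_series_at_0\<close>). For the infinite tooth \<open>K\<close> is a Gaussian. Nothing bounds \<open>\<partial>\<^sub>y \<phi>\<close> far
  out, so the tooth is cut at \<open>R\<close> and the kernel is reflected there, which removes the unknown flux from
  the boundary terms (\<open>reflected_pairing\<close>); the remaining ones vanish as \<open>R\<close> grows.
\<close>

section \<open>Uniform limits of antiderivatives\<close>

text \<open>
  The integral may be improper at both ends: the derivatives are controlled on compact
  subintervals of the open interval only. What takes the place of a majorant is that the
  antiderivatives converge uniformly up to the end points, which makes the limit antiderivative
  continuous there; the Henstock--Kurzweil form of the fundamental theorem asks for no more.
\<close>
lemma has_integral_of_locally_uniform_derivatives: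
  fixes F D :: "nat \<Rightarrow> real \<Rightarrow> real" and d :: "real \<Rightarrow> real"
  assumes "0 < t"
    and cont: "\<And>N. continuous_on {0..t} (F N)"
    and cauchy: "uniformly_Cauchy_on {0..t} F"
    and deriv: "\<And>N s. 0 < s \<Longrightarrow> s < t \<Longrightarrow> (F N has_real_derivative D N s) (at s)"
    and lim: "\<And>a b. 0 < a \<Longrightarrow> a < b \<Longrightarrow> b < t \<Longrightarrow> uniform_limit {a..b} D d sequentially"
    and A: "(\<lambda>N. F N 0) \<longlonglongrightarrow> A" and B: "(\<lambda>N. F N t) \<longlonglongrightarrow> B"
  shows "(d has_integral B - A) {0..t}"
proof -
  obtain G where G: "uniform_limit {0..t} F G sequentially"
    using Cauchy_uniformly_convergent[OF cauchy] by (auto simp: uniformly_convergent_on_def)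
  have G_lim: "(\<lambda>N. F N s) \<longlonglongrightarrow> G s" if "s \<in> {0..t}" for s
    using tendsto_uniform_limitI[OF G that] .
  have "G 0 = A" "G t = B"
    using LIMSEQ_unique[OF G_lim A] LIMSEQ_unique[OF G_lim B] \<open>0 < t\<close> by auto
  have contG: "continuous_on {0..t} G"
    by (rule uniform_limit_theorem[OF _ G]) (auto simp: cont)
  have "(G has_vector_derivative d s) (at s)" if "s \<in> {0<..<t}" for s
  proof -
    define a b where "a = s / 2" and "b = (s + t) / 2"
    have ab: "0 < a" "a < s" "s < b" "b < t" using that by (auto simp: a_def b_def)
    have unif: "uniform_limit {a..b} D d sequentially" using ab lim by auto
    have "\<exists>g. \<forall>x\<in>{a..b}. (\<lambda>n. F n x) \<longlonglongrightarrow> g x \<and> (g has_derivative (\<lambda>h. d x * h)) (at x within {a..b})"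
    proof (rule has_derivative_sequence[where f' = "\<lambda>n x h. D n x * h" and ?x0.0 = s and l = "G s"])
      show "(F n has_derivative (\<lambda>h. D n x * h)) (at x within {a..b})" if "x \<in> {a..b}" for n x
        using deriv[of x n] that ab
        by (auto simp: has_field_derivative_def intro: has_derivative_at_withinI)
      show "\<forall>\<^sub>F n in sequentially. \<forall>x\<in>{a..b}. \<forall>h. norm (D n x * h - d x * h) \<le> e * norm h"
        if "e > 0" for e
        using uniform_limitD[OF unif that]
      proof eventually_elim
        case (elim n)
        show ?case
        proof (intro ballI allI)
          fix x h assume "x \<in> {a..b}"
          with elim have "\<bar>D n x - d x\<bar> \<le> e" by (auto simp: dist_real_def intro: less_imp_le)
          then show "norm (D n x * h - d x * h) \<le> e * norm h"
            by (metis abs_ge_zero abs_mult left_diff_distrib mult_right_mono real_norm_def)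
        qed
      qed
    qed (use ab G_lim[of s] in auto)
    then obtain g where g: "\<And>x. x \<in> {a..b} \<Longrightarrow> (\<lambda>n. F n x) \<longlonglongrightarrow> g x"
      "\<And>x. x \<in> {a..b} \<Longrightarrow> (g has_derivative (\<lambda>h. d x * h)) (at x within {a..b})" by blast
    have "g x = G x" if "x \<in> {a..b}" for x
      using LIMSEQ_unique[OF g(1)[OF that] G_lim[of x]] that ab by auto
    then have "(G has_derivative (\<lambda>h. d s * h)) (at s within {a..b})"
      using g(2)[of s] ab by (intro has_derivative_transform[of s "{a..b}" G g]) auto
    moreover have "at s within {a..b} = at s"
      using ab by (intro at_within_interior) auto
    ultimately show ?thesis
      by (simp add: has_real_derivative_iff_has_vector_derivative[symmetric] has_field_derivative_def)
  qed
  then have "(d has_integral G t - G 0) {0..t}"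
    using \<open>0 < t\<close> contG by (intro fundamental_theorem_of_calculus_interior) auto
  with \<open>G 0 = A\<close> \<open>G t = B\<close> show ?thesis by simp
qed

lemma uniformly_Cauchy_on_Un:
  assumes "uniformly_Cauchy_on X f" "uniformly_Cauchy_on Y f"
  shows "uniformly_Cauchy_on (X \<union> Y) f"
proof (rule uniformly_Cauchy_onI)
  fix e :: real assume "0 < e"
  with assms obtain m n where "\<forall>x\<in>X. \<forall>i\<ge>m. \<forall>j\<ge>m. dist (f i x) (f j x) < e"
    "\<forall>x\<in>Y. \<forall>i\<ge>n. \<forall>j\<ge>n. dist (f i x) (f j x) < e"
    unfolding uniformly_Cauchy_on_def by metis
  then show "\<exists>M. \<forall>x\<in>X \<union> Y. \<forall>i\<ge>M. \<forall>j\<ge>M. dist (f i x) (f j x) < e"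
    by (intro exI[of _ "max m n"]) auto
qed

text \<open>
  By the Cauchy--Schwarz inequality a block of the sum is at most \<open>sqrt D\<close> times the \<open>\<ell>\<^sup>2\<close> norm of a
  block of \<open>\<beta>\<close>, which does not involve \<open>s\<close>. Here \<open>\<alpha>\<close> stands for Fourier coefficients that depend on
  time: Bessel's inequality bounds their \<open>\<ell>\<^sup>2\<close> norms uniformly, which is weaker than a summable
  majorant of the individual terms.
\<close>
lemma uniformly_Cauchy_on_sum_square_bounded:
  fixes \<alpha> :: "nat \<Rightarrow> 'a \<Rightarrow> real" and \<beta> :: "nat \<Rightarrow> real"
  assumes \<alpha>: "\<And>A s. finite A \<Longrightarrow> s \<in> X \<Longrightarrow> (\<Sum>k\<in>A. (\<alpha> k s)\<^sup>2) \<le> D"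
    and \<beta>: "summable (\<lambda>k. (\<beta> k)\<^sup>2)"
  shows "uniformly_Cauchy_on X (\<lambda>n s. \<Sum>k<n. \<alpha> k s * \<beta> k)"
proof (rule uniformly_Cauchy_onI')
  fix e :: real assume "0 < e"
  \<comment> \<open>A strictly positive bound, so that it can be divided by.\<close>
  define D' where "D' = \<bar>D\<bar> + 1"
  have "0 < D'" "D \<le> D'" by (auto simp: D'_def)
  with \<open>0 < e\<close> have "0 < e\<^sup>2 / D'" by simp
  with \<beta> obtain N where N: "\<And>m n. m \<ge> N \<Longrightarrow> \<bar>\<Sum>k\<in>{m..<n}. (\<beta> k)\<^sup>2\<bar> < e\<^sup>2 / D'"
    unfolding summable_Cauchy real_norm_def by metis
  have "dist (\<Sum>k<m. \<alpha> k s * \<beta> k) (\<Sum>k<n. \<alpha> k s * \<beta> k) < e"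
    if s: "s \<in> X" and mn: "N \<le> m" "m < n" for s m n
  proof -
    have "(\<Sum>k<n. \<alpha> k s * \<beta> k) - (\<Sum>k<m. \<alpha> k s * \<beta> k) = (\<Sum>k\<in>{m..<n}. \<alpha> k s * \<beta> k)"
      using sum_diff_nat_ivl[of 0 m n "\<lambda>k. \<alpha> k s * \<beta> k"] mn by (simp add: lessThan_atLeast0)
    then have "dist (\<Sum>k<m. \<alpha> k s * \<beta> k) (\<Sum>k<n. \<alpha> k s * \<beta> k) = \<bar>\<Sum>k\<in>{m..<n}. \<alpha> k s * \<beta> k\<bar>"
      by (subst dist_commute) (simp only: dist_real_def)
    moreover have "(\<Sum>k\<in>{m..<n}. \<alpha> k s * \<beta> k)\<^sup>2 < e\<^sup>2"
    proof -
      have "(\<Sum>k\<in>{m..<n}. \<alpha> k s * \<beta> k)\<^sup>2 \<le> (\<Sum>k\<in>{m..<n}. (\<alpha> k s)\<^sup>2) * (\<Sum>k\<in>{m..<n}. (\<beta> k)\<^sup>2)"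
        by (rule Cauchy_Schwarz_ineq_sum)
      also have "\<dots> \<le> D' * (\<Sum>k\<in>{m..<n}. (\<beta> k)\<^sup>2)"
        using \<alpha>[OF _ s, of "{m..<n}"] \<open>D \<le> D'\<close> by (intro mult_right_mono sum_nonneg) auto
      also have "\<dots> < D' * (e\<^sup>2 / D')"
        using N[OF mn(1), of n] \<open>0 < D'\<close> by (intro mult_strict_left_mono) auto
      finally show ?thesis using \<open>0 < D'\<close> by simp
    qed
    then have "\<bar>\<Sum>k\<in>{m..<n}. \<alpha> k s * \<beta> k\<bar> < e"
      using \<open>0 < e\<close> power_less_imp_less_base[of "\<bar>\<Sum>k\<in>{m..<n}. \<alpha> k s * \<beta> k\<bar>" 2 e] by simp
    ultimately show ?thesis by simp
  qed
  then show "\<exists>M. \<forall>x\<in>X. \<forall>m\<ge>M. \<forall>n>m. dist (\<Sum>k<m. \<alpha> k x * \<beta> k) (\<Sum>k<n. \<alpha> k x * \<beta> k) < e"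
    by blast
qed

section \<open>Fourier series with mixed boundary conditions\<close>

lemma bessel_inequality:
  fixes f :: "real \<Rightarrow> real" and e :: "nat \<Rightarrow> real \<Rightarrow> real"
  assumes f: "continuous_on {a..b} f" and e: "\<And>k. continuous_on {a..b} (e k)"
    and orth: "\<And>i j. i \<in> A \<Longrightarrow> j \<in> A \<Longrightarrow>
      integral {a..b} (\<lambda>y. e i y * e j y) = (if i = j then c else 0)"
    and "finite A" and "0 < c"
  shows "(\<Sum>k\<in>A. (integral {a..b} (\<lambda>y. f y * e k y))\<^sup>2) \<le> c * integral {a..b} (\<lambda>y. (f y)\<^sup>2)"
proof -
  define m where "m k = integral {a..b} (\<lambda>y. f y * e k y)" for k
  define g where "g y = (\<Sum>k\<in>A. m k / c * e k y)" for y
  note [continuous_intros] = f e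
  have int [intro]: "continuous_on {a..b} r \<Longrightarrow> r integrable_on {a..b}" for r :: "real \<Rightarrow> real"
    by (rule integrable_continuous_real)
  have fg: "integral {a..b} (\<lambda>y. f y * g y) = (\<Sum>k\<in>A. (m k)\<^sup>2) / c"
  proof -
    have "integral {a..b} (\<lambda>y. f y * g y) = integral {a..b} (\<lambda>y. \<Sum>k\<in>A. m k / c * (f y * e k y))"
      unfolding g_def by (simp add: sum_distrib_left mult_ac)
    also have "\<dots> = (\<Sum>k\<in>A. integral {a..b} (\<lambda>y. m k / c * (f y * e k y)))"
      using \<open>finite A\<close> \<open>0 < c\<close> by (intro integral_sum) (auto intro!: continuous_intros)
    also have "\<dots> = (\<Sum>k\<in>A. (m k)\<^sup>2 / c)"
      by (intro sum.cong) (auto simp: m_def power2_eq_square)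
    finally show ?thesis by (simp add: sum_divide_distrib)
  qed
  have gg: "integral {a..b} (\<lambda>y. g y * g y) = (\<Sum>k\<in>A. (m k)\<^sup>2) / c"
  proof -
    have "integral {a..b} (\<lambda>y. g y * g y)
        = integral {a..b} (\<lambda>y. \<Sum>i\<in>A. \<Sum>j\<in>A. m i / c * (m j / c) * (e i y * e j y))"
      unfolding g_def by (simp add: sum_product mult_ac)
    also have "\<dots> = (\<Sum>i\<in>A. integral {a..b} (\<lambda>y. \<Sum>j\<in>A. m i / c * (m j / c) * (e i y * e j y)))"
      using \<open>finite A\<close> \<open>0 < c\<close> by (intro integral_sum) (auto intro!: continuous_intros)
    also have "\<dots> = (\<Sum>i\<in>A. \<Sum>j\<in>A. integral {a..b} (\<lambda>y. m i / c * (m j / c) * (e i y * e j y)))"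
      using \<open>finite A\<close> \<open>0 < c\<close> by (intro sum.cong refl integral_sum) (auto intro!: continuous_intros)
    also have "\<dots> = (\<Sum>i\<in>A. \<Sum>j\<in>A. if i = j then (m i)\<^sup>2 / c else 0)"
      using orth \<open>0 < c\<close> by (intro sum.cong refl) (auto simp: power2_eq_square)
    also have "\<dots> = (\<Sum>k\<in>A. (m k)\<^sup>2) / c"
      using \<open>finite A\<close> by (simp add: sum_divide_distrib)
    finally show ?thesis .
  qed
  have contg: "continuous_on {a..b} g" unfolding g_def by (intro continuous_intros)
  have "0 \<le> integral {a..b} (\<lambda>y. (f y - g y)\<^sup>2)"
    by (intro integral_nonneg) (auto intro!: continuous_intros contg)
  also have "\<dots> = integral {a..b} (\<lambda>y. ((f y)\<^sup>2 - 2 * (f y * g y)) + g y * g y)"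
    by (simp add: power2_eq_square algebra_simps)
  also have "\<dots> = integral {a..b} (\<lambda>y. (f y)\<^sup>2) - 2 * integral {a..b} (\<lambda>y. f y * g y)
      + integral {a..b} (\<lambda>y. g y * g y)"
    by (subst integral_add integral_diff; auto intro!: continuous_intros contg)+
  finally show ?thesis
    unfolding fg gg m_def[symmetric] using \<open>0 < c\<close> by (simp add: field_simps)
qed

lemma integral_cos_multiple:
  fixes h :: real
  assumes "0 < h"
  shows "integral {0..h} (\<lambda>y. cos (of_int m * pi * y / h)) = (if m = 0 then h else 0)"
proof (cases "m = 0")
  case False
  have "((\<lambda>y. cos (of_int m * pi * y / h)) has_integral
      (h / (of_int m * pi) * sin (of_int m * pi * h / h) - h / (of_int m * pi) * sin (of_int m * pi * 0 / h))) {0..h}"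
    using assms False
    by (intro fundamental_theorem_of_calculus)
      (auto intro!: derivative_eq_intros simp: has_real_derivative_iff_has_vector_derivative[symmetric])
  then show ?thesis using False assms by (simp add: integral_unique sin_zero_iff_int2)
qed (use assms in simp)

lemma integral_sin_times_sin:
  fixes h p q :: real
  assumes "0 < h" and m: "p - q = of_int m" and n: "p + q = of_int n" "n \<noteq> 0"
  shows "integral {0..h} (\<lambda>y. sin (p * pi * y / h) * sin (q * pi * y / h)) = (if m = 0 then h / 2 else 0)"
proof -
  have "sin (p * pi * y / h) * sin (q * pi * y / h)
      = (1/2) * (cos (of_int m * pi * y / h) - cos (of_int n * pi * y / h))" for y
    unfolding m[symmetric] n[symmetric]
    by (simp add: sin_times_sin diff_divide_distrib add_divide_distrib left_diff_distrib distrib_right)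
  then have "integral {0..h} (\<lambda>y. sin (p * pi * y / h) * sin (q * pi * y / h))
     = (1/2) * integral {0..h} (\<lambda>y. cos (of_int m * pi * y / h) - cos (of_int n * pi * y / h))"
    by (simp only: integral_mult_right)
  also have "\<dots> = (1/2) * (integral {0..h} (\<lambda>y. cos (of_int m * pi * y / h))
      - integral {0..h} (\<lambda>y. cos (of_int n * pi * y / h)))"
    using assms by (subst integral_diff) (auto intro!: integrable_continuous_real continuous_intros)
  finally show ?thesis using n by (auto simp: integral_cos_multiple[OF \<open>0 < h\<close>] split: if_splits)
qed

text \<open>
  The sum telescopes after multiplication by \<open>2 sin \<theta>\<close>. Odd multiples of \<open>\<theta>\<close> occur because of the
  mixed boundary conditions, whose frequencies are half-integer multiples of \<open>\<pi>/h\<close>.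
\<close>
lemma dirichlet_kernel_odd:
  fixes \<theta> :: real
  shows "(\<Sum>k<n. cos ((2 * real k + 1) * \<theta>)) * (2 * sin \<theta>) = sin (2 * real n * \<theta>)"
proof (induction n)
  case (Suc n)
  have "sin (2 * real (Suc n) * \<theta>) - sin (2 * real n * \<theta>) = cos ((2 * real n + 1) * \<theta>) * (2 * sin \<theta>)"
    by (simp add: sin_diff_sin algebra_simps) (simp add: add_divide_distrib mult_ac)
  with Suc show ?case by (simp add: algebra_simps)
qed simp

text \<open>
  The Riemann--Lebesgue lemma: the squares of these coefficients are summable by Bessel's inequality.
\<close>
lemma integral_sin_tendsto_0:
  fixes D :: "real \<Rightarrow> real"
  assumes "0 < h" and D: "continuous_on {0..h} D"
  shows "(\<lambda>n. integral {0..h} (\<lambda>y. D y * sin (real n * pi * y / h))) \<longlonglongrightarrow> 0"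
proof -
  define m where "m k = integral {0..h} (\<lambda>y. D y * sin (real (Suc k) * pi * y / h))" for k
  have "(\<Sum>k\<in>{..<n}. (m k)\<^sup>2) \<le> h / 2 * integral {0..h} (\<lambda>y. (D y)\<^sup>2)" for n
    unfolding m_def
  proof (rule bessel_inequality[OF D])
    show "integral {0..h} (\<lambda>y. sin (real (Suc i) * pi * y / h) * sin (real (Suc j) * pi * y / h))
        = (if i = j then h / 2 else 0)" for i j
      using integral_sin_times_sin[OF \<open>0 < h\<close>, of "real (Suc i)" "real (Suc j)"
          "int i - int j" "int i + int j + 2"] by simp
  qed (use \<open>0 < h\<close> in \<open>auto intro!: continuous_intros\<close>)
  then have "summable (\<lambda>k. (m k)\<^sup>2)"
    by (rule summableI_nonneg_bounded[rotated]) simp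
  then have "m \<longlonglongrightarrow> 0"
    using summable_LIMSEQ_zero by fastforce
  then show ?thesis
    unfolding m_def by (rule LIMSEQ_imp_Suc)
qed

text \<open>
  The functions \<open>sin (mode h k * y)\<close> are the eigenfunctions of the tooth with Dirichlet condition
  at \<open>y = 0\<close> and Neumann condition at \<open>y = h\<close>; the decay rates \<open>(mode h k)\<^sup>2 / 2\<close> of the heat flow are
  the exponents in the Caputo kernel.
\<close>
definition mode :: "real \<Rightarrow> nat \<Rightarrow> real" where
  "mode h k = (2 * real k + 1) * pi / (2 * h)"

lemma mode_pos: "0 < h \<Longrightarrow> 0 < mode h k"
  by (simp add: mode_def)

lemma cos_mode_end: "0 < h \<Longrightarrow> cos (mode h k * h) = 0"
  by (auto simp: mode_def cos_zero_iff_int intro!: exI[of _ "2 * int k + 1"])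

lemma sin_mode_end: 
  assumes "0 < h" shows "sin (mode h k * h) = (-1) ^ k"
proof -
  have "mode h k * h = pi / 2 + real k * pi" using assms by (simp add: mode_def field_simps)
  then show ?thesis by (simp add: sin_add)
qed

text \<open>
  The constant \<open>p 0\<close> contributes the Leibniz series for \<open>\<pi>/4\<close>. For \<open>p - p 0\<close> the Dirichlet kernel turns
  the partial sum into a sine coefficient of the quotient of \<open>p y - p 0\<close> by \<open>2 sin (\<pi>y/2h)\<close>, which is
  continuous up to \<open>0\<close> because \<open>p\<close> is differentiable there; the Riemann--Lebesgue lemma disposes of it.
\<close>
lemma cosine_series_at_0:
  fixes p :: "real \<Rightarrow> real"
  assumes "0 < h" and p: "continuous_on {0..h} p"
    and p': "(p has_real_derivative d) (at 0 within {0..h})"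
  shows "(\<lambda>k. 2 / h * integral {0..h} (\<lambda>y. p y * cos (mode h k * y))) sums p 0"
proof -
  note [continuous_intros] = p
  \<comment> \<open>The value at \<open>0\<close> is the limit of the quotient, \<open>d\<close> divided by the derivative \<open>\<pi>/h\<close> of the denominator.\<close>
  define D where "D y = (if y = 0 then d * h / pi else (p y - p 0) / (2 * sin (pi * y / (2 * h))))" for y
  have sin_pos: "0 < sin (pi * y / (2 * h))" if "0 < y" "y \<le> h" for y
  proof (rule sin_gt_zero)
    have "pi * y / (2 * h) \<le> pi / 2" using that by (simp add: field_simps)
    then show "pi * y / (2 * h) < pi" using pi_gt_zero by linarith
  qed (use that \<open>0 < h\<close> in simp)
  have "continuous_on {0..h} D"
    unfolding continuous_on_eq_continuous_within
  proof
    fix y assume y: "y \<in> {0..h}"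
    show "continuous (at y within {0..h}) D"
    proof (cases "y = 0")
      case True
      have "((\<lambda>z. (p z - p 0) / (z - 0)) \<longlongrightarrow> d) (at 0 within {0..h})"
        using p' by (simp add: has_field_derivative_iff)
      moreover have "((\<lambda>z. (2 * sin (pi * z / (2 * h)) - 2 * sin (pi * 0 / (2 * h))) / (z - 0)) \<longlongrightarrow> pi / h) (at 0 within {0..h})"
        unfolding has_field_derivative_iff[where f = "\<lambda>z. 2 * sin (pi * z / (2 * h))", symmetric]
        using \<open>0 < h\<close> by (auto intro!: derivative_eq_intros)
      ultimately have "((\<lambda>z. ((p z - p 0) / (z - 0)) / ((2 * sin (pi * z / (2 * h)) - 2 * sin (pi * 0 / (2 * h))) / (z - 0)))
          \<longlongrightarrow> d / (pi / h)) (at 0 within {0..h})"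
        by (rule tendsto_divide) (use \<open>0 < h\<close> in simp)
      then have "(D \<longlongrightarrow> d / (pi / h)) (at 0 within {0..h})"
        by (rule Lim_transform_within[where d = 1]) (auto simp: D_def)
      with True show ?thesis by (simp add: continuous_within D_def)
    next
      case False
      with y have y: "0 < y" "y \<le> h" by auto
      have "continuous (at y within {0..h}) (\<lambda>y. (p y - p 0) / (2 * sin (pi * y / (2 * h))))"
        using sin_pos[OF y] p y \<open>0 < h\<close>
        by (auto intro!: continuous_intros simp: continuous_on_eq_continuous_within)
      then show ?thesis
        by (rule continuous_transform_within[where \<delta> = y]) (use y in \<open>auto simp: D_def dist_real_def\<close>)
    qed
  qed
  then have rl: "(\<lambda>n. integral {0..h} (\<lambda>y. D y * sin (real n * pi * y / h))) \<longlonglongrightarrow> 0"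
    by (rule integral_sin_tendsto_0[OF \<open>0 < h\<close>])
  have leibniz: "(\<lambda>k. 2 / h * integral {0..h} (\<lambda>y. cos (mode h k * y))) sums 1"
  proof -
    have "(\<lambda>k. 4 / pi * ((-1) ^ k * 1 / real (k * 2 + 1))) sums (4 / pi * (pi / 4))"
      unfolding pi_series by (intro sums_mult summable_sums) (use summable_arctan_series[of 1] in simp)
    moreover have "2 / h * integral {0..h} (\<lambda>y. cos (mode h k * y)) = 4 / pi * ((-1) ^ k * 1 / real (k * 2 + 1))" for k
    proof -
      have "((\<lambda>y. cos (mode h k * y)) has_integral
          (sin (mode h k * h) / mode h k - sin (mode h k * 0) / mode h k)) {0..h}"
        using \<open>0 < h\<close> mode_pos[OF \<open>0 < h\<close>, of k]
        by (intro fundamental_theorem_of_calculus)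
          (auto intro!: derivative_eq_intros simp: has_real_derivative_iff_has_vector_derivative[symmetric])
      then have "integral {0..h} (\<lambda>y. cos (mode h k * y)) = (-1) ^ k / mode h k"
        by (simp add: integral_unique sin_mode_end[OF \<open>0 < h\<close>])
      then show ?thesis using \<open>0 < h\<close> by (simp add: mode_def field_simps)
    qed
    ultimately show ?thesis by simp
  qed
  have split: "(\<Sum>k<n. 2 / h * integral {0..h} (\<lambda>y. p y * cos (mode h k * y)))
      = 2 / h * integral {0..h} (\<lambda>y. D y * sin (real n * pi * y / h))
        + p 0 * (\<Sum>k<n. 2 / h * integral {0..h} (\<lambda>y. cos (mode h k * y)))" for n
  proof -
    have "integral {0..h} (\<lambda>y. D y * sin (real n * pi * y / h))
        = integral {0..h} (\<lambda>y. \<Sum>k<n. p y * cos (mode h k * y) - p 0 * cos (mode h k * y))"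
    proof (rule integral_cong)
      fix y assume y: "y \<in> {0..h}"
      have "(\<Sum>k<n. cos (mode h k * y)) * (2 * sin (pi * y / (2 * h))) = sin (real n * pi * y / h)"
        using dirichlet_kernel_odd[of "pi * y / (2 * h)" n] \<open>0 < h\<close>
        by (simp add: mode_def field_simps)
      then have "D y * sin (real n * pi * y / h) = (p y - p 0) * (\<Sum>k<n. cos (mode h k * y))"
        using sin_pos[of y] y by (cases "y = 0") (auto simp: D_def field_simps)
      then show "D y * sin (real n * pi * y / h) = (\<Sum>k<n. p y * cos (mode h k * y) - p 0 * cos (mode h k * y))"
        by (simp add: sum_distrib_left left_diff_distrib sum_subtractf)
    qed
    also have "\<dots> = (\<Sum>k<n. integral {0..h} (\<lambda>y. p y * cos (mode h k * y) - p 0 * cos (mode h k * y)))"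
      by (intro integral_sum) (auto intro!: integrable_continuous_real continuous_intros)
    also have "\<dots> = (\<Sum>k<n. integral {0..h} (\<lambda>y. p y * cos (mode h k * y))
        - p 0 * integral {0..h} (\<lambda>y. cos (mode h k * y)))"
      by (intro sum.cong refl) (subst integral_diff; auto intro!: integrable_continuous_real continuous_intros)
    finally show ?thesis
      unfolding sum_distrib_left[symmetric] sum_subtractf
      by (simp only: right_diff_distrib) (simp add: mult_ac)
  qed
  have "(\<lambda>n. 2 / h * integral {0..h} (\<lambda>y. D y * sin (real n * pi * y / h))
        + p 0 * (\<Sum>k<n. 2 / h * integral {0..h} (\<lambda>y. cos (mode h k * y)))) \<longlonglongrightarrow> 2 / h * 0 + p 0 * 1"
    using leibniz unfolding sums_def by (intro tendsto_intros rl)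
  then show ?thesis unfolding sums_def split by simp
qed

lemma exp_minus_le_inverse: "0 < x \<Longrightarrow> exp (- x) \<le> 1 / x" for x :: real
proof -
  assume "0 < x"
  moreover have "x \<le> exp x" using exp_ge_add_one_self[of x] by linarith
  ultimately show ?thesis by (simp add: exp_minus field_simps)
qed

lemma exp_minus_le_inverse_square: "0 < x \<Longrightarrow> exp (- x) \<le> 4 / x\<^sup>2" for x :: real
  using power_mono[OF exp_minus_le_inverse[of "x / 2"], of 2]
  by (simp add: exp_double[symmetric] power_divide)

lemma summable_inverse_mode_square:
  assumes "0 < h"
  shows "summable (\<lambda>k. 1 / (mode h k)\<^sup>2)"
proof (rule summable_comparison_test')
  show "summable (\<lambda>k. (2 * h / pi)\<^sup>2 * inverse ((real (Suc k))\<^sup>2))"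
    using inverse_power_summable[of 2, where 'a = real] 
    by (intro summable_mult) (subst summable_Suc_iff, auto)
  show "norm (1 / (mode h k)\<^sup>2) \<le> (2 * h / pi)\<^sup>2 * inverse ((real (Suc k))\<^sup>2)" for k
  proof -
    have "1 / mode h k \<le> 2 * h / pi * inverse (real (Suc k))"
      using assms by (simp add: mode_def divide_simps)
    then have "(1 / mode h k)\<^sup>2 \<le> (2 * h / pi * inverse (real (Suc k)))\<^sup>2"
      using mode_pos[OF assms, of k] by (intro power_mono) auto
    then show ?thesis by (simp add: power_divide power_mult_distrib power_inverse)
  qed
qed

lemma summable_mode_exp:
  assumes "0 < h" and "0 < \<tau>"
  shows "summable (\<lambda>k. exp (- ((mode h k)\<^sup>2 / 2 * \<tau>)))" (is "summable ?e")
    and "summable (\<lambda>k. mode h k * exp (- ((mode h k)\<^sup>2 / 2 * \<tau>)))"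
proof -
  show 1: "summable ?e"
  proof (rule summable_comparison_test'[OF summable_mult[OF summable_inverse_mode_square[OF \<open>0 < h\<close>], of "2 / \<tau>"]])
    show "norm (?e k) \<le> 2 / \<tau> * (1 / (mode h k)\<^sup>2)" for k
      using exp_minus_le_inverse[of "(mode h k)\<^sup>2 / 2 * \<tau>"] mode_pos[OF \<open>0 < h\<close>, of k] \<open>0 < \<tau>\<close> by (simp add: field_simps)
  qed
  have "summable (\<lambda>k. (mode h k)\<^sup>2 * ?e k)"
  proof (rule summable_comparison_test'[OF summable_mult[OF summable_inverse_mode_square[OF \<open>0 < h\<close>], of "16 / \<tau>\<^sup>2"]])
    show "norm ((mode h k)\<^sup>2 * ?e k) \<le> 16 / \<tau>\<^sup>2 * (1 / (mode h k)\<^sup>2)" for k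
    proof -
      have m: "0 < mode h k" by (rule mode_pos[OF \<open>0 < h\<close>])
      have "(mode h k)\<^sup>2 * ?e k \<le> (mode h k)\<^sup>2 * (4 / ((mode h k)\<^sup>2 / 2 * \<tau>)\<^sup>2)"
        by (intro mult_left_mono exp_minus_le_inverse_square) (use m \<open>0 < \<tau>\<close> in auto)
      also have "\<dots> = 16 / \<tau>\<^sup>2 * (1 / (mode h k)\<^sup>2)"
        using m \<open>0 < \<tau>\<close> by (simp add: power2_eq_square field_simps)
      finally show ?thesis by simp
    qed
  qed
  then have s: "summable (\<lambda>k. ?e k + (mode h k)\<^sup>2 * ?e k)" by (intro summable_add 1)
  show "summable (\<lambda>k. mode h k * ?e k)"
  proof (rule summable_comparison_test'[OF s])
    fix k
    have "mode h k \<le> 1 + (mode h k)\<^sup>2"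
      using zero_le_power2[of "mode h k - 1/2"] by (simp add: power2_eq_square algebra_simps)
    then have "mode h k * ?e k \<le> (1 + (mode h k)\<^sup>2) * ?e k" by (intro mult_right_mono) auto
    then show "norm (mode h k * ?e k) \<le> ?e k + (mode h k)\<^sup>2 * ?e k"
      using mode_pos[OF \<open>0 < h\<close>, of k] by (simp add: algebra_simps)
  qed
qed

section \<open>Heat flows in a tooth\<close>

text \<open>
  The flow to have in mind is \<open>\<phi> y s = u x y s - g x y s - u0 x 0\<close> for a fixed \<open>x\<close>. Subtracting \<open>g\<close>
  makes the initial data vanish on the whole tooth, and since \<open>g\<close> vanishes on the spine, \<open>\<phi> 0\<close> still
  differs from the trace of \<open>u\<close> by a constant only. By the heat equation the time derivative is
  recorded as \<open>\<phi>yy / 2\<close>, so that \<open>\<phi>yy 0 s / 2\<close> is the derivative of the trace.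
\<close>
locale heat_flow =
  fixes J :: "real set" and \<phi> \<phi>y \<phi>yy :: "real \<Rightarrow> real \<Rightarrow> real" and M :: real
  assumes bounded: "\<And>y s. y \<in> J \<Longrightarrow> 0 \<le> s \<Longrightarrow> \<bar>\<phi> y s\<bar> \<le> M"
    and cont: "continuous_on (J \<times> {0..}) (\<lambda>(y, s). \<phi> y s)"
    and cont_y: "continuous_on (J \<times> {0<..}) (\<lambda>(y, s). \<phi>y y s)"
    and cont_yy: "continuous_on (J \<times> {0<..}) (\<lambda>(y, s). \<phi>yy y s)"
    and heat: "\<And>y s. y \<in> J \<Longrightarrow> 0 < s \<Longrightarrow> ((\<lambda>s. \<phi> y s) has_real_derivative \<phi>yy y s / 2) (at s)"
    and deriv_y: "\<And>y s. y \<in> J \<Longrightarrow> 0 < s \<Longrightarrow> ((\<lambda>y. \<phi> y s) has_real_derivative \<phi>y y s) (at y within J)"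
    and deriv_yy: "\<And>y s. y \<in> J \<Longrightarrow> 0 < s \<Longrightarrow> ((\<lambda>y. \<phi>y y s) has_real_derivative \<phi>yy y s) (at y within J)"
    and initial: "\<And>y. y \<in> J \<Longrightarrow> \<phi> y 0 = 0"
    and spine: "0 \<in> J"
begin

lemma M_nonneg: "0 \<le> M"
  using bounded[OF spine, of 0] by linarith

lemma cont_phi [continuous_intros]:
  assumes "continuous_on X a" "continuous_on X b" "\<And>x. x \<in> X \<Longrightarrow> a x \<in> J" "\<And>x. x \<in> X \<Longrightarrow> 0 \<le> b x"
  shows "continuous_on X (\<lambda>x. \<phi> (a x) (b x))"
  using continuous_on_compose2[OF cont, of X "\<lambda>x. (a x, b x)"] assms
  by (auto intro!: continuous_on_Pair)

lemma cont_phiy [continuous_intros]: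
  assumes "continuous_on X a" "continuous_on X b" "\<And>x. x \<in> X \<Longrightarrow> a x \<in> J" "\<And>x. x \<in> X \<Longrightarrow> 0 < b x"
  shows "continuous_on X (\<lambda>x. \<phi>y (a x) (b x))"
  using continuous_on_compose2[OF cont_y, of X "\<lambda>x. (a x, b x)"] assms
  by (auto intro!: continuous_on_Pair)

lemma cont_phiyy [continuous_intros]:
  assumes "continuous_on X a" "continuous_on X b" "\<And>x. x \<in> X \<Longrightarrow> a x \<in> J" "\<And>x. x \<in> X \<Longrightarrow> 0 < b x"
  shows "continuous_on X (\<lambda>x. \<phi>yy (a x) (b x))"
  using continuous_on_compose2[OF cont_yy, of X "\<lambda>x. (a x, b x)"] assms
  by (auto intro!: continuous_on_Pair)

lemma pairing_continuous:
  assumes "{0..R} \<subseteq> J" and "X \<subseteq> {0..}"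
    and q: "continuous_on (X \<times> {0..R}) (\<lambda>(s, y). q y s)"
  shows "continuous_on X (\<lambda>s. integral {0..R} (\<lambda>y. \<phi> y s * q y s))"
proof -
  have "continuous_on (X \<times> cbox 0 R) (\<lambda>(s, y). \<phi> y s * q y s)"
    using assms by (auto simp: split_beta intro!: continuous_intros)
  from integral_continuous_on_param[OF this] show ?thesis by simp
qed

text \<open>
  Green's second identity: since \<open>q\<close> solves the backward heat equation, the time derivative of
  \<open>\<phi> * q\<close> is the \<open>y\<close>-derivative of \<open>(\<phi>y * q - \<phi> * qy) / 2\<close>, and only boundary terms survive.
\<close>
lemma pairing_derivative:
  assumes R: "{0..R} \<subseteq> J" "0 \<le> R" and s: "0 < s" "s < t"
    and q_s: "\<And>y s. y \<in> {0..R} \<Longrightarrow> 0 < s \<Longrightarrow> s < t \<Longrightarrow>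
      ((\<lambda>s. q y s) has_real_derivative - (qyy y s / 2)) (at s)"
    and q_y: "\<And>y s. y \<in> {0..R} \<Longrightarrow> 0 < s \<Longrightarrow> s < t \<Longrightarrow>
      ((\<lambda>y. q y s) has_real_derivative qy y s) (at y)"
    and q_yy: "\<And>y s. y \<in> {0..R} \<Longrightarrow> 0 < s \<Longrightarrow> s < t \<Longrightarrow>
      ((\<lambda>y. qy y s) has_real_derivative qyy y s) (at y)"
    and cont_q: "continuous_on ({0<..<t} \<times> {0..R}) (\<lambda>(s, y). q y s)"
    and cont_qyy: "continuous_on ({0<..<t} \<times> {0..R}) (\<lambda>(s, y). qyy y s)"
  shows "((\<lambda>s. integral {0..R} (\<lambda>y. \<phi> y s * q y s)) has_real_derivative
      ((\<phi>y R s * q R s - \<phi> R s * qy R s) - (\<phi>y 0 s * q 0 s - \<phi> 0 s * qy 0 s)) / 2) (at s)"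
proof -
  let ?D = "\<lambda>s y. (\<phi>yy y s * q y s - \<phi> y s * qyy y s) / 2"
  have "((\<lambda>s. integral (cbox 0 R) (\<lambda>y. \<phi> y s * q y s)) has_real_derivative
      integral (cbox 0 R) (?D s)) (at s within {0<..<t})"
  proof (rule leibniz_rule_field_derivative)
    show "((\<lambda>s. \<phi> y s * q y s) has_real_derivative ?D s y) (at s within {0<..<t})"
      if "s \<in> {0<..<t}" "y \<in> cbox 0 R" for s y
    proof -
      have "y \<in> J" "y \<in> {0..R}" "0 < s" "s < t" using that R by auto
      from DERIV_mult[OF heat[OF this(1,3)] q_s[OF this(2-4)]]
      have "((\<lambda>s. \<phi> y s * q y s) has_real_derivative ?D s y) (at s)"
        by (simp add: field_simps)
      then show ?thesis by (rule has_field_derivative_at_within)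
    qed
    show "(\<lambda>y. \<phi> y s * q y s) integrable_on cbox 0 R" if "s \<in> {0<..<t}" for s
    proof -
      have "continuous_on {0..R} (\<lambda>y. q y s)"
        using that q_y by (intro DERIV_continuous_on) (auto intro: DERIV_subset)
      then show ?thesis
        using R that by (auto intro!: integrable_continuous_real continuous_intros)
    qed
    show "continuous_on ({0<..<t} \<times> cbox 0 R) (\<lambda>(s, y). ?D s y)"
      using R cont_q cont_qyy by (auto simp: split_beta intro!: continuous_intros)
  qed (use s in auto)
  moreover have "(?D s has_integral (\<phi>y R s * q R s - \<phi> R s * qy R s) / 2
      - (\<phi>y 0 s * q 0 s - \<phi> 0 s * qy 0 s) / 2) {0..R}"
  proof (rule fundamental_theorem_of_calculus)
    fix y assume y: "y \<in> {0..R}"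
    then have "y \<in> J" using R by auto
    then have d: "((\<lambda>y. \<phi> y s) has_real_derivative \<phi>y y s) (at y within {0..R})"
      "((\<lambda>y. \<phi>y y s) has_real_derivative \<phi>yy y s) (at y within {0..R})"
      "((\<lambda>y. q y s) has_real_derivative qy y s) (at y within {0..R})"
      "((\<lambda>y. qy y s) has_real_derivative qyy y s) (at y within {0..R})"
      using deriv_y[of y s] deriv_yy[of y s] q_y[of y s] q_yy[of y s] y s R
      by (auto intro: DERIV_subset)
    have "((\<lambda>y. (\<phi>y y s * q y s - \<phi> y s * qy y s) / 2) has_real_derivative ?D s y) (at y within {0..R})"
      using d by (auto intro!: derivative_eq_intros simp: field_simps)
    then show "((\<lambda>y. (\<phi>y y s * q y s - \<phi> y s * qy y s) / 2) has_vector_derivative ?D s y) (at y within {0..R})"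
      by (simp add: has_real_derivative_iff_has_vector_derivative)
  qed (use R in auto)
  moreover have "at s within {0<..<t} = at s"
    using s by (intro at_within_open) auto
  ultimately show ?thesis
    by (simp add: integral_unique diff_divide_distrib)
qed

lemma bounded_on_rectangles:
  assumes "compact Y" "Y \<subseteq> J" "compact S" "S \<subseteq> {0<..}"
  shows "\<exists>C. \<forall>y\<in>Y. \<forall>s\<in>S. \<bar>\<phi>y y s\<bar> \<le> C \<and> \<bar>\<phi>yy y s\<bar> \<le> C"
proof -
  have "compact (Y \<times> S)" by (intro compact_Times assms)
  moreover have "continuous_on (Y \<times> S) (\<lambda>p. \<phi>y (fst p) (snd p))" "continuous_on (Y \<times> S) (\<lambda>p. \<phi>yy (fst p) (snd p))"
    using assms by (auto intro!: continuous_intros)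
  ultimately have "bounded ((\<lambda>p. \<phi>y (fst p) (snd p)) ` (Y \<times> S))" "bounded ((\<lambda>p. \<phi>yy (fst p) (snd p)) ` (Y \<times> S))"
    by (auto intro: compact_imp_bounded compact_continuous_image)
  then obtain C1 C2 where C: "\<forall>p\<in>Y \<times> S. \<bar>\<phi>y (fst p) (snd p)\<bar> \<le> C1" "\<forall>p\<in>Y \<times> S. \<bar>\<phi>yy (fst p) (snd p)\<bar> \<le> C2"
    unfolding bounded_iff real_norm_def by blast
  then show ?thesis
    by (intro exI[of _ "max C1 C2"]) (auto simp: le_max_iff_disj)
qed

end

section \<open>The flux into a bounded tooth\<close>

context heat_flow
begin

text \<open>
  The pairing of \<open>\<phi> s\<close> with the \<open>k\<close>-th mode, propagated backward from time \<open>t\<close> and corrected by the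
  trace, is called \<open>B k s\<close>; up to the factor \<open>- 2 / h\<close> its derivative is the \<open>k\<close>-th term of the integrand.
  Integration by parts shows that \<open>B k s\<close> is a damped cosine coefficient of the flux \<open>\<phi>y s\<close>, so the sum
  of the \<open>2 / h * B k\<close> is the flux \<open>\<phi>y 0 t\<close> at \<open>s = t\<close>, by the cosine series at \<open>0\<close>; at \<open>s = 0\<close> it
  vanishes with the initial data.
\<close>
lemma flux_identity_bounded_tooth:
  assumes h: "0 < h" and J: "J = {0..h}" and no_flux: "\<And>s. 0 < s \<Longrightarrow> \<phi>y h s = 0" and t: "0 < t"
  shows "((\<lambda>s. 2 / h * (\<Sum>k. exp (- ((mode h k)\<^sup>2 / 2 * (t - s)))) * (\<phi>yy 0 s / 2))
    has_integral - \<phi>y 0 t) {0..t}"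
proof -
  define e where "e k s = exp (- ((mode h k)\<^sup>2 / 2 * (t - s)))" for k s
  define B where "B k s = integral {0..h} (\<lambda>y. \<phi> y s * (mode h k * sin (mode h k * y) * e k s)) - \<phi> 0 s * e k s" for k s
  \<comment> \<open>Bounded second derivatives give \<open>c k s\<close> square summable, hence one power of \<open>mode h k\<close> more decay.\<close>
  define c where "c k s = integral {0..h} (\<lambda>y. \<phi>yy y s * sin (mode h k * y))" for k s
  have m: "0 < mode h k" for k by (rule mode_pos[OF h])
  have cont_e [continuous_intros]: "continuous_on X (\<lambda>x. e k (b x))"
    if "continuous_on X b" for X :: "'z::topological_space set" and b k
    unfolding e_def by (rule continuous_intros that | simp)+
  have e_pos: "0 < e k s" for k s by (simp add: e_def)
  have e_le: "e k s \<le> exp (- ((mode h k)\<^sup>2 / 2 * (t - b)))" if "s \<le> b" for k s b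
  proof -
    have "(mode h k)\<^sup>2 / 2 * (t - b) \<le> (mode h k)\<^sup>2 / 2 * (t - s)"
      using that by (intro mult_left_mono) auto
    then show ?thesis by (simp add: e_def)
  qed
  have contB: "continuous_on {0..t} (B k)" for k
    unfolding B_def
  proof (intro continuous_on_diff pairing_continuous)
    show "continuous_on ({0..t} \<times> {0..h}) (\<lambda>(s, y). mode h k * sin (mode h k * y) * e k s)"
      unfolding split_beta by (intro continuous_intros)
    show "continuous_on {0..t} (\<lambda>s. \<phi> 0 s * e k s)"
      using spine by (intro continuous_intros) auto
  qed (use J in auto)
  \<comment> \<open>At \<open>h\<close> both boundary terms vanish; at \<open>0\<close> what is left cancels the derivative of \<open>e k\<close> in the correction.\<close>
  have derivB: "(B k has_real_derivative - (\<phi>yy 0 s / 2 * e k s)) (at s)" if s: "0 < s" "s < t" for k s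
  proof -
    have "((\<lambda>s. integral {0..h} (\<lambda>y. \<phi> y s * (mode h k * sin (mode h k * y) * e k s))) has_real_derivative
        ((\<phi>y h s * (mode h k * sin (mode h k * h) * e k s) - \<phi> h s * ((mode h k)\<^sup>2 * cos (mode h k * h) * e k s))
         - (\<phi>y 0 s * (mode h k * sin (mode h k * 0) * e k s) - \<phi> 0 s * ((mode h k)\<^sup>2 * cos (mode h k * 0) * e k s))) / 2) (at s)"
    proof (rule pairing_derivative[where t = t and qyy = "\<lambda>y s. - ((mode h k) ^ 3 * sin (mode h k * y) * e k s)"])
      show "((\<lambda>s. mode h k * sin (mode h k * y) * e k s) has_real_derivative
          - (- (mode h k ^ 3 * sin (mode h k * y) * e k s) / 2)) (at s)" for y s
        unfolding e_def by (auto intro!: derivative_eq_intros simp: power2_eq_square power3_eq_cube)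
      show "((\<lambda>y. mode h k * sin (mode h k * y) * e k s) has_real_derivative
          (mode h k)\<^sup>2 * cos (mode h k * y) * e k s) (at y)" for y s
        by (auto intro!: derivative_eq_intros simp: power2_eq_square)
      show "((\<lambda>y. (mode h k)\<^sup>2 * cos (mode h k * y) * e k s) has_real_derivative
          - (mode h k ^ 3 * sin (mode h k * y) * e k s)) (at y)" for y s
        by (auto intro!: derivative_eq_intros simp: power2_eq_square power3_eq_cube)
    qed (use h J s in \<open>auto simp: split_beta intro!: continuous_intros\<close>)
    then have 1: "((\<lambda>s. integral {0..h} (\<lambda>y. \<phi> y s * (mode h k * sin (mode h k * y) * e k s))) has_real_derivative
        \<phi> 0 s * ((mode h k)\<^sup>2 * e k s) / 2) (at s)"
      using no_flux[OF s(1)] cos_mode_end[OF h, of k] by simp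
    have 2: "(e k has_real_derivative (mode h k)\<^sup>2 / 2 * e k s) (at s)"
      unfolding e_def by (auto intro!: derivative_eq_intros)
    show ?thesis
      unfolding B_def using DERIV_diff[OF 1 DERIV_mult[OF heat[OF spine s(1)] 2]]
      by (simp add: algebra_simps)
  qed
  have B0: "B k 0 = 0" for k
    using h J initial by (auto simp: B_def intro!: integral_unique has_integral_eq[OF _ has_integral_0])
  have parts: "B k s = e k s * integral {0..h} (\<lambda>y. \<phi>y y s * cos (mode h k * y))"
    "integral {0..h} (\<lambda>y. \<phi>y y s * cos (mode h k * y)) = - (c k s / mode h k)" if s: "0 < s" for k s
  proof -
    have "((\<lambda>y. \<phi>y y s * cos (mode h k * y) - \<phi> y s * (mode h k * sin (mode h k * y))) has_integral
        (\<phi> h s * cos (mode h k * h) - \<phi> 0 s * cos (mode h k * 0))) {0..h}"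
    proof (rule fundamental_theorem_of_calculus)
      show "((\<lambda>y. \<phi> y s * cos (mode h k * y)) has_vector_derivative
          \<phi>y y s * cos (mode h k * y) - \<phi> y s * (mode h k * sin (mode h k * y))) (at y within {0..h})"
        if "y \<in> {0..h}" for y
        using deriv_y[of y s] that s J unfolding has_real_derivative_iff_has_vector_derivative[symmetric]
        by (auto intro!: derivative_eq_intros)
    qed (use h in simp)
    then have "integral {0..h} (\<lambda>y. \<phi>y y s * cos (mode h k * y))
        - integral {0..h} (\<lambda>y. \<phi> y s * (mode h k * sin (mode h k * y))) = - \<phi> 0 s"
      using h J s cos_mode_end[OF h, of k]
      by (subst integral_diff[symmetric])
        (auto simp: integral_unique intro!: integrable_continuous_real continuous_intros)
    then have Iy: "integral {0..h} (\<lambda>y. \<phi>y y s * cos (mode h k * y))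
        = integral {0..h} (\<lambda>y. \<phi> y s * (mode h k * sin (mode h k * y))) - \<phi> 0 s"
      by linarith
    have I: "integral {0..h} (\<lambda>y. \<phi> y s * (mode h k * sin (mode h k * y) * e k s))
        = e k s * integral {0..h} (\<lambda>y. \<phi> y s * (mode h k * sin (mode h k * y)))"
      by (subst integral_mult_right[symmetric]) (simp add: mult_ac)
    show "B k s = e k s * integral {0..h} (\<lambda>y. \<phi>y y s * cos (mode h k * y))"
      unfolding B_def I Iy by (simp only: right_diff_distrib mult.commute[of "\<phi> 0 s"])
    have "((\<lambda>y. \<phi>y y s * cos (mode h k * y) + \<phi>yy y s * sin (mode h k * y) / mode h k) has_integral
        (\<phi>y h s * sin (mode h k * h) / mode h k - \<phi>y 0 s * sin (mode h k * 0) / mode h k)) {0..h}"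
    proof (rule fundamental_theorem_of_calculus)
      show "((\<lambda>y. \<phi>y y s * sin (mode h k * y) / mode h k) has_vector_derivative
          \<phi>y y s * cos (mode h k * y) + \<phi>yy y s * sin (mode h k * y) / mode h k) (at y within {0..h})"
        if "y \<in> {0..h}" for y
        using deriv_yy[of y s] that s J m[of k] unfolding has_real_derivative_iff_has_vector_derivative[symmetric]
        by (auto intro!: derivative_eq_intros simp: field_simps)
    qed (use h in simp)
    then have "integral {0..h} (\<lambda>y. \<phi>y y s * cos (mode h k * y))
        + integral {0..h} (\<lambda>y. \<phi>yy y s * sin (mode h k * y) / mode h k) = 0"
      using h J s no_flux[OF s] m[of k]
      by (subst integral_add[symmetric])
        (auto simp: integral_unique intro!: integrable_continuous_real continuous_intros)
    then show "integral {0..h} (\<lambda>y. \<phi>y y s * cos (mode h k * y)) = - (c k s / mode h k)"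
      by (simp add: c_def)
  qed
  define F where "F N s = (\<Sum>k<N. 2 / h * B k s)" for N s
  have "((\<lambda>s. - (2 / h * (\<Sum>k. e k s) * (\<phi>yy 0 s / 2))) has_integral \<phi>y 0 t - 0) {0..t}"
  proof (rule has_integral_of_locally_uniform_derivatives[where F = F
        and D = "\<lambda>N s. \<Sum>k<N. 2 / h * - (\<phi>yy 0 s / 2 * e k s)"])
    show "continuous_on {0..t} (F N)" for N
      unfolding F_def by (intro continuous_intros contB)
    show "(F N has_real_derivative (\<Sum>k<N. 2 / h * - (\<phi>yy 0 s / 2 * e k s))) (at s)" if "0 < s" "s < t" for N s
      unfolding F_def by (intro DERIV_sum DERIV_cmult derivB that)
    show "(\<lambda>N. F N 0) \<longlonglongrightarrow> 0"
      by (simp add: F_def B0)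
    show "(\<lambda>N. F N t) \<longlonglongrightarrow> \<phi>y 0 t"
    proof -
      have "(\<lambda>k. 2 / h * integral {0..h} (\<lambda>y. \<phi>y y t * cos (mode h k * y))) sums \<phi>y 0 t"
        using h J t deriv_yy[OF spine t]
        by (intro cosine_series_at_0[where d = "\<phi>yy 0 t"]) (auto intro!: continuous_intros)
      then show ?thesis
        using t by (simp add: sums_def F_def parts(1) e_def)
    qed
    show "uniform_limit {a..b} (\<lambda>N s. \<Sum>k<N. 2 / h * - (\<phi>yy 0 s / 2 * e k s))
        (\<lambda>s. - (2 / h * (\<Sum>k. e k s) * (\<phi>yy 0 s / 2))) sequentially" if ab: "0 < a" "a < b" "b < t" for a b
    proof -
      have "{a..b} \<subseteq> {0<..}" using ab by auto
      then obtain C where C: "\<And>s. s \<in> {a..b} \<Longrightarrow> \<bar>\<phi>yy 0 s\<bar> \<le> C"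
        using bounded_on_rectangles[of "{0}" "{a..b}"] spine by fastforce
      have sum_e: "summable (\<lambda>k. exp (- ((mode h k)\<^sup>2 / 2 * (t - b))))"
        using ab by (intro summable_mode_exp h) auto
      have lim: "uniform_limit {a..b} (\<lambda>N s. \<Sum>k<N. 2 / h * - (\<phi>yy 0 s / 2 * e k s))
          (\<lambda>s. \<Sum>k. 2 / h * - (\<phi>yy 0 s / 2 * e k s)) sequentially"
      proof (rule Weierstrass_m_test[OF _ summable_mult[OF sum_e, of "C / h"]])
        fix k s assume s: "s \<in> {a..b}"
        have "\<bar>\<phi>yy 0 s\<bar> * e k s \<le> C * exp (- ((mode h k)\<^sup>2 / 2 * (t - b)))"
          using C[OF s] e_le[of s b k] e_pos[of k s] s by (intro mult_mono) auto
        then show "norm (2 / h * - (\<phi>yy 0 s / 2 * e k s)) \<le> C / h * exp (- ((mode h k)\<^sup>2 / 2 * (t - b)))"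
          using h e_pos[of k s] by (simp add: abs_mult divide_right_mono)
      qed
      have eq: "(\<Sum>k. 2 / h * - (\<phi>yy 0 s / 2 * e k s)) = - (2 / h * (\<Sum>k. e k s) * (\<phi>yy 0 s / 2))"
        if "s \<in> {a..b}" for s
      proof -
        have "summable (\<lambda>k. e k s)"
          unfolding e_def using ab that by (intro summable_mode_exp h) auto
        then have "(\<Sum>k. - (2 / h) * (\<phi>yy 0 s / 2) * e k s) = - (2 / h) * (\<phi>yy 0 s / 2) * (\<Sum>k. e k s)"
          by (rule suminf_mult)
        then show ?thesis by (simp add: mult_ac)
      qed
      show ?thesis
        by (rule iffD1[OF uniform_limit_cong'[OF refl eq] lim])
    qed
    show "uniformly_Cauchy_on {0..t} F"
    proof -
      \<comment> \<open>Away from \<open>t\<close> the damping gives a majorant, and boundedness of \<open>\<phi>\<close> is enough.\<close>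
      have "uniformly_convergent_on {0..t / 2} (\<lambda>N s. \<Sum>k<N. 2 / h * B k s)"
      proof (rule Weierstrass_m_test')
        show "summable (\<lambda>k. 2 / h * (M * h * (mode h k * exp (- ((mode h k)\<^sup>2 / 2 * (t / 2)))) + M * exp (- ((mode h k)\<^sup>2 / 2 * (t / 2)))))"
          using t by (intro summable_mult summable_add summable_mode_exp h) auto
        fix k s assume s: "s \<in> {0..t / 2}"
        have e: "0 < e k s" "e k s \<le> exp (- ((mode h k)\<^sup>2 / 2 * (t / 2)))"
          using e_pos e_le[of s "t / 2" k] s by auto
        have "norm (integral {0..h} (\<lambda>y. \<phi> y s * (mode h k * sin (mode h k * y) * e k s)))
            \<le> M * (mode h k * 1 * e k s) * (h - 0)"
        proof (rule integral_bound)
          show "norm (\<phi> y s * (mode h k * sin (mode h k * y) * e k s)) \<le> M * (mode h k * 1 * e k s)" if "y \<in> {0..h}" for y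
            unfolding norm_mult using that s J m[of k] e(1) bounded[of y s] M_nonneg
            by (intro mult_mono) auto
        qed (use h J s in \<open>auto intro!: continuous_intros\<close>)
        moreover have "norm (\<phi> 0 s * e k s) \<le> M * e k s"
          using bounded[OF spine, of s] s e(1) by (simp add: abs_mult)
        ultimately have "\<bar>B k s\<bar> \<le> M * h * (mode h k * e k s) + M * e k s"
          unfolding B_def by (simp add: algebra_simps)
        also have "\<dots> \<le> M * h * (mode h k * exp (- ((mode h k)\<^sup>2 / 2 * (t / 2)))) + M * exp (- ((mode h k)\<^sup>2 / 2 * (t / 2)))"
          using e M_nonneg h m[of k] by (intro add_mono mult_left_mono) auto
        finally show "norm (2 / h * B k s) \<le> 2 / h * (M * h * (mode h k * exp (- ((mode h k)\<^sup>2 / 2 * (t / 2)))) + M * exp (- ((mode h k)\<^sup>2 / 2 * (t / 2))))"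
          unfolding norm_mult using h by (intro mult_mono) auto
      qed
      then have 1: "uniformly_Cauchy_on {0..t / 2} F"
        unfolding F_def by (rule uniformly_convergent_Cauchy)
      \<comment> \<open>Near \<open>t\<close> the damping degenerates; there \<open>\<phi>yy\<close> is bounded and Bessel's inequality takes over.\<close>
      have "{t / 2..t} \<subseteq> {0<..}" using t by auto
      then obtain C where C: "\<And>y s. y \<in> {0..h} \<Longrightarrow> s \<in> {t / 2..t} \<Longrightarrow> \<bar>\<phi>yy y s\<bar> \<le> C"
        using bounded_on_rectangles[of "{0..h}" "{t / 2..t}"] J by fastforce
      have "uniformly_Cauchy_on {t / 2..t} (\<lambda>N s. \<Sum>k<N. (- (2 / h) * e k s * c k s) * (1 / mode h k))"
      proof (rule uniformly_Cauchy_on_sum_square_bounded)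
        show "summable (\<lambda>k. (1 / mode h k)\<^sup>2)"
          using summable_inverse_mode_square[OF h] by (simp add: power_divide)
        fix A :: "nat set" and s assume "finite A" and s: "s \<in> {t / 2..t}"
        have cont: "continuous_on {0..h} (\<lambda>y. \<phi>yy y s)"
          using s J t by (intro continuous_intros) auto
        have "(\<Sum>k\<in>A. (c k s)\<^sup>2) \<le> h / 2 * integral {0..h} (\<lambda>y. (\<phi>yy y s)\<^sup>2)"
          unfolding c_def
        proof (rule bessel_inequality[OF cont])
          show "integral {0..h} (\<lambda>y. sin (mode h i * y) * sin (mode h j * y)) = (if i = j then h / 2 else 0)" for i j
            using integral_sin_times_sin[OF h, of "real i + 1 / 2" "real j + 1 / 2" "int i - int j" "int i + int j + 1"] h
            by (simp add: mode_def field_simps)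
        qed (use h \<open>finite A\<close> in \<open>auto intro!: continuous_intros\<close>)
        also have "integral {0..h} (\<lambda>y. (\<phi>yy y s)\<^sup>2) \<le> C\<^sup>2 * (h - 0)"
        proof -
          have "norm (integral {0..h} (\<lambda>y. (\<phi>yy y s)\<^sup>2)) \<le> C\<^sup>2 * (h - 0)"
          proof (rule integral_bound)
            show "norm ((\<phi>yy y s)\<^sup>2) \<le> C\<^sup>2" if "y \<in> {0..h}" for y
              using power_mono[OF C[OF that s], of 2] by simp
          qed (use h cont in \<open>auto intro!: continuous_intros\<close>)
          then show ?thesis by simp
        qed
        finally have c: "(\<Sum>k\<in>A. (c k s)\<^sup>2) \<le> h / 2 * (C\<^sup>2 * (h - 0))"
          using h by simp
        have "(\<Sum>k\<in>A. (- (2 / h) * e k s * c k s)\<^sup>2) \<le> (\<Sum>k\<in>A. (2 / h)\<^sup>2 * (c k s)\<^sup>2)"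
        proof (rule sum_mono)
          fix k
          have "(e k s)\<^sup>2 \<le> 1"
            using e_le[of s t k] e_pos[of k s] s by (intro power_le_one) auto
          then have "(2 / h)\<^sup>2 * (c k s)\<^sup>2 * (e k s)\<^sup>2 \<le> (2 / h)\<^sup>2 * (c k s)\<^sup>2"
            by (intro mult_left_le) auto
          then show "(- (2 / h) * e k s * c k s)\<^sup>2 \<le> (2 / h)\<^sup>2 * (c k s)\<^sup>2"
            by (simp add: power_mult_distrib power_divide mult_ac)
        qed
        also have "\<dots> \<le> (2 / h)\<^sup>2 * (h / 2 * (C\<^sup>2 * (h - 0)))"
          unfolding sum_distrib_left[symmetric] by (intro mult_left_mono c) auto
        finally show "(\<Sum>k\<in>A. (- (2 / h) * e k s * c k s)\<^sup>2) \<le> (2 / h)\<^sup>2 * (h / 2 * (C\<^sup>2 * (h - 0)))" .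
      qed
      moreover have "F N s = (\<Sum>k<N. (- (2 / h) * e k s * c k s) * (1 / mode h k))" if "s \<in> {t / 2..t}" for N s
        unfolding F_def using that t by (intro sum.cong) (auto simp: parts)
      ultimately have 2: "uniformly_Cauchy_on {t / 2..t} F"
        by (simp add: uniformly_Cauchy_on_def)
      have "{0..t / 2} \<union> {t / 2..t} = {0..t}" using t by auto
      then show ?thesis
        using uniformly_Cauchy_on_Un[OF 1 2] by simp
    qed
  qed (use t in auto)
  from has_integral_neg[OF this] show ?thesis by (simp add: e_def)
qed

end

section \<open>The Gaussian dipole\<close>

text \<open>
  The heat kernel of the half-line with Neumann condition and source at \<open>0\<close>. On the spine \<open>y = 0\<close> it
  is the Caputo kernel of the infinite tooth.
\<close>
definition gauss_kernel :: "real \<Rightarrow> real \<Rightarrow> real" where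
  "gauss_kernel y \<tau> = sqrt (2 / (pi * \<tau>)) * exp (- (y\<^sup>2 / (2 * \<tau>)))"

text \<open>
  The negative \<open>y\<close>-derivative of \<open>gauss_kernel\<close>. It vanishes at \<open>y = 0\<close> and plays the role of the sum
  of the sine modes of the bounded tooth.
\<close>
definition dipole :: "real \<Rightarrow> real \<Rightarrow> real" where
  "dipole y \<tau> = gauss_kernel y \<tau> * (y / \<tau>)"

definition dipole_y :: "real \<Rightarrow> real \<Rightarrow> real" where
  "dipole_y y \<tau> = gauss_kernel y \<tau> * (1 / \<tau> - y\<^sup>2 / \<tau>\<^sup>2)"

definition dipole_yy :: "real \<Rightarrow> real \<Rightarrow> real" where
  "dipole_yy y \<tau> = gauss_kernel y \<tau> * (y ^ 3 / \<tau> ^ 3 - 3 * y / \<tau>\<^sup>2)"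

lemma gauss_kernel_pos: "0 < \<tau> \<Longrightarrow> 0 < gauss_kernel y \<tau>"
  by (simp add: gauss_kernel_def)

lemma dipole_nonneg: "0 < \<tau> \<Longrightarrow> 0 \<le> y \<Longrightarrow> 0 \<le> dipole y \<tau>"
  using gauss_kernel_pos[of \<tau> y] by (simp add: dipole_def)

lemma continuous_on_gauss_kernel [continuous_intros]:
  assumes "continuous_on X a" "continuous_on X b" "\<And>x. x \<in> X \<Longrightarrow> 0 < b x"
  shows "continuous_on X (\<lambda>x. gauss_kernel (a x) (b x))"
  unfolding gauss_kernel_def using assms by (intro continuous_intros) (auto simp: less_imp_neq[symmetric] dest: assms(3))

lemma continuous_on_dipole [continuous_intros]:
  assumes "continuous_on X a" "continuous_on X b" "\<And>x. x \<in> X \<Longrightarrow> 0 < b x"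
  shows "continuous_on X (\<lambda>x. dipole (a x) (b x))"
  unfolding dipole_def using assms by (intro continuous_intros) (auto dest: assms(3))

lemma continuous_on_dipole_yy [continuous_intros]:
  assumes "continuous_on X a" "continuous_on X b" "\<And>x. x \<in> X \<Longrightarrow> 0 < b x"
  shows "continuous_on X (\<lambda>x. dipole_yy (a x) (b x))"
  unfolding dipole_yy_def using assms by (intro continuous_intros) (auto dest: assms(3))

lemma gauss_kernel_deriv_y:
  assumes "0 < \<tau>"
  shows "((\<lambda>y. gauss_kernel y \<tau>) has_real_derivative - dipole y \<tau>) (at y within Y)"
  unfolding gauss_kernel_def dipole_def using assms
  by (auto intro!: derivative_eq_intros simp: field_simps)

lemma dipole_deriv_y:
  assumes "0 < \<tau>"
  shows "((\<lambda>y. dipole y \<tau>) has_real_derivative dipole_y y \<tau>) (at y within Y)"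
proof -
  have "((\<lambda>y. gauss_kernel y \<tau> * (y / \<tau>)) has_real_derivative
      gauss_kernel y \<tau> * (1 / \<tau>) + - dipole y \<tau> * (y / \<tau>)) (at y within Y)"
    using assms by (intro DERIV_mult' gauss_kernel_deriv_y) (auto intro!: derivative_eq_intros)
  then show ?thesis
    unfolding dipole_def dipole_y_def by (simp add: power2_eq_square algebra_simps)
qed

lemma dipole_deriv_yy:
  assumes "0 < \<tau>"
  shows "((\<lambda>y. dipole_y y \<tau>) has_real_derivative dipole_yy y \<tau>) (at y within Y)"
proof -
  have "((\<lambda>y. gauss_kernel y \<tau> * (1 / \<tau> - y\<^sup>2 / \<tau>\<^sup>2)) has_real_derivative
      gauss_kernel y \<tau> * (- (2 * y / \<tau>\<^sup>2)) + - dipole y \<tau> * (1 / \<tau> - y\<^sup>2 / \<tau>\<^sup>2)) (at y within Y)"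
    using assms by (intro DERIV_mult' gauss_kernel_deriv_y)
      (auto intro!: derivative_eq_intros simp: power4_eq_xxxx power2_eq_square)
  then show ?thesis
    unfolding dipole_y_def
    by (rule DERIV_cong) (use assms in \<open>simp add: dipole_def dipole_yy_def power2_eq_square power3_eq_cube field_simps\<close>)
qed

lemma gauss_kernel_deriv_time:
  assumes "0 < \<tau>"
  shows "((\<lambda>\<tau>. gauss_kernel y \<tau>) has_real_derivative - dipole_y y \<tau> / 2) (at \<tau>)"
proof -
  let ?w = "\<lambda>\<tau>. sqrt (2 / (pi * \<tau>))"
  have w: "(?w has_real_derivative - (?w \<tau> / (2 * \<tau>))) (at \<tau>)"
  proof -
    have "(?w has_real_derivative inverse (?w \<tau>) / 2 * (- (2 / (pi * \<tau>)) / \<tau>)) (at \<tau>)"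
      using assms
      by (intro DERIV_chain2[where f = sqrt] DERIV_real_sqrt)
        (auto intro!: derivative_eq_intros simp: field_simps)
    moreover have "inverse (?w \<tau>) / 2 * (- (2 / (pi * \<tau>)) / \<tau>) = - (?w \<tau> / (2 * \<tau>))"
    proof -
      have "2 / (pi * \<tau>) = ?w \<tau> * ?w \<tau>" using assms by simp
      moreover have "?w \<tau> \<noteq> 0" using assms by simp
      ultimately show ?thesis by (simp add: field_simps)
    qed
    ultimately show ?thesis by simp
  qed
  have "((\<lambda>\<tau>. exp (- (y\<^sup>2 / (2 * \<tau>)))) has_real_derivative exp (- (y\<^sup>2 / (2 * \<tau>))) * (y\<^sup>2 / (2 * \<tau>\<^sup>2))) (at \<tau>)"
    using assms by (auto intro!: derivative_eq_intros simp: field_simps power2_eq_square)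
  from DERIV_mult'[OF w this] show ?thesis
    unfolding gauss_kernel_def
    by (rule DERIV_cong) (use assms in \<open>simp add: dipole_y_def gauss_kernel_def field_simps power2_eq_square\<close>)
qed

lemma dipole_heat:
  assumes "0 < \<tau>"
  shows "((\<lambda>\<tau>. dipole y \<tau>) has_real_derivative dipole_yy y \<tau> / 2) (at \<tau>)"
proof -
  have "((\<lambda>\<tau>. gauss_kernel y \<tau> * (y / \<tau>)) has_real_derivative
      gauss_kernel y \<tau> * (- (y / \<tau>\<^sup>2)) + (- dipole_y y \<tau> / 2) * (y / \<tau>)) (at \<tau>)"
    using assms by (intro DERIV_mult' gauss_kernel_deriv_time)
      (auto intro!: derivative_eq_intros simp: power2_eq_square)
  then show ?thesis
    unfolding dipole_def
    by (rule DERIV_cong) (use assms in \<open>simp add: dipole_y_def dipole_yy_def field_simps power2_eq_square power3_eq_cube\<close>)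
qed

lemma dipole_mass:
  assumes "0 < \<tau>" "a \<le> b"
  shows "((\<lambda>y. dipole y \<tau>) has_integral gauss_kernel a \<tau> - gauss_kernel b \<tau>) {a..b}"
proof -
  have "((\<lambda>y. - (- dipole y \<tau>)) has_integral - (gauss_kernel b \<tau> - gauss_kernel a \<tau>)) {a..b}"
    using assms gauss_kernel_deriv_y[OF assms(1)]
    by (intro has_integral_neg fundamental_theorem_of_calculus)
      (auto simp: has_real_derivative_iff_has_vector_derivative[symmetric])
  then show ?thesis by simp
qed

lemma reflected_dipole_mass:
  assumes "0 < \<tau>" "0 \<le> R"
  shows "((\<lambda>y. dipole (2 * R - y) \<tau>) has_integral gauss_kernel R \<tau> - gauss_kernel (2 * R) \<tau>) {0..R}"
proof -
  have "((\<lambda>y. gauss_kernel (2 * R - y) \<tau>) has_real_derivative dipole (2 * R - y) \<tau>) (at y within {0..R})" for y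
  proof -
    have "((\<lambda>y. 2 * R - y) has_real_derivative -1) (at y within {0..R})"
      by (auto intro!: derivative_eq_intros)
    from DERIV_chain2[where f = "\<lambda>y. gauss_kernel y \<tau>", OF gauss_kernel_deriv_y[OF assms(1)] this]
    show ?thesis by simp
  qed
  then have "((\<lambda>y. dipole (2 * R - y) \<tau>) has_integral
      gauss_kernel (2 * R - R) \<tau> - gauss_kernel (2 * R - 0) \<tau>) {0..R}"
    using assms by (intro fundamental_theorem_of_calculus)
      (auto simp: has_real_derivative_iff_has_vector_derivative[symmetric])
  then show ?thesis by simp
qed

text \<open>
  The bound stays useful as \<open>\<tau>\<close> tends to \<open>0\<close>: away from the spine the exponential beats the
  singularity \<open>\<tau>\<^bsup>-1/2\<^esup>\<close> of the kernel.
\<close>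
lemma gauss_kernel_far:
  assumes "0 < \<tau>" "0 < y"
  shows "gauss_kernel y \<tau> \<le> 2 * sqrt (2 * \<tau> / pi) / y\<^sup>2"
proof -
  have "exp (- (y\<^sup>2 / (2 * \<tau>))) \<le> 2 * \<tau> / y\<^sup>2"
  proof -
    have "y\<^sup>2 / (2 * \<tau>) \<le> exp (y\<^sup>2 / (2 * \<tau>))"
      using exp_ge_add_one_self[of "y\<^sup>2 / (2 * \<tau>)"] by linarith
    then show ?thesis using assms by (simp add: exp_minus field_simps)
  qed
  then have "gauss_kernel y \<tau> \<le> sqrt (2 / (pi * \<tau>)) * (2 * \<tau> / y\<^sup>2)"
    unfolding gauss_kernel_def using assms by (intro mult_left_mono) auto
  also have "\<dots> = 2 * (sqrt (2 / (pi * \<tau>)) * \<tau>) / y\<^sup>2" by simp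
  also have "sqrt (2 / (pi * \<tau>)) * \<tau> = sqrt (2 / (pi * \<tau>)) * sqrt (\<tau>\<^sup>2)" using assms by simp
  also have "\<dots> = sqrt (2 * \<tau> / pi)"
    unfolding real_sqrt_mult[symmetric] using assms by (simp add: power2_eq_square)
  finally show ?thesis .
qed

text \<open>
  For times bounded away from \<open>0\<close> the boundary terms of a truncation at \<open>y\<close> are negligible, uniformly
  in time. The rate \<open>1 / y\<close> is far from sharp.
\<close>
lemma dipole_far:
  assumes "0 < \<tau>\<^sub>0"
  shows "\<exists>K\<ge>0. \<forall>\<tau>\<in>{\<tau>\<^sub>0..t}. \<forall>y\<ge>1. \<bar>dipole y \<tau>\<bar> \<le> K / y \<and> \<bar>dipole_y y \<tau>\<bar> \<le> K / y"
proof -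
  define G where "G = sqrt (2 / (pi * \<tau>\<^sub>0)) * (16 * t\<^sup>2)"
  have G0: "0 \<le> G" by (auto simp: G_def assms less_imp_le)
  have "\<bar>dipole y \<tau>\<bar> \<le> G * (1 / \<tau>\<^sub>0 + 1 / \<tau>\<^sub>0\<^sup>2) / y \<and> \<bar>dipole_y y \<tau>\<bar> \<le> G * (1 / \<tau>\<^sub>0 + 1 / \<tau>\<^sub>0\<^sup>2) / y"
    if \<tau>: "\<tau> \<in> {\<tau>\<^sub>0..t}" and y: "1 \<le> y" for \<tau> y
  proof -
    have pos: "0 < \<tau>" "0 < t" "0 < y" using \<tau> y assms by auto
    have "exp (- (y\<^sup>2 / (2 * \<tau>))) \<le> exp (- (y\<^sup>2 / (2 * t)))"
      using \<tau> pos by (auto intro!: divide_left_mono)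
    also have "\<dots> \<le> 4 / (y\<^sup>2 / (2 * t))\<^sup>2"
      by (rule exp_minus_le_inverse_square) (use pos in simp)
    also have "\<dots> = 16 * t\<^sup>2 / y ^ 4"
      using pos by (simp add: field_simps power2_eq_square power4_eq_xxxx)
    finally have "gauss_kernel y \<tau> \<le> sqrt (2 / (pi * \<tau>\<^sub>0)) * (16 * t\<^sup>2 / y ^ 4)"
      unfolding gauss_kernel_def using \<tau> pos assms by (intro mult_mono) (auto intro!: divide_left_mono)
    then have gk: "gauss_kernel y \<tau> \<le> G / y ^ 4" "0 < gauss_kernel y \<tau>"
      using gauss_kernel_pos[OF pos(1)] by (simp_all add: G_def)
    have inv: "1 / \<tau> \<le> 1 / \<tau>\<^sub>0" "1 / \<tau>\<^sup>2 \<le> 1 / \<tau>\<^sub>0\<^sup>2"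
      using \<tau> assms pos by (auto intro!: divide_left_mono power_mono)
    have "y * (1 / \<tau>) \<le> y ^ 3 * (1 / \<tau>\<^sub>0 + 1 / \<tau>\<^sub>0\<^sup>2)"
    proof (rule mult_mono)
      show "y \<le> y ^ 3" using power_increasing[of 1 3 y] y by simp
      show "1 / \<tau> \<le> 1 / \<tau>\<^sub>0 + 1 / \<tau>\<^sub>0\<^sup>2" using inv assms by (auto intro: add_increasing2)
    qed (use pos in auto)
    moreover have "1 / \<tau> + y\<^sup>2 * (1 / \<tau>\<^sup>2) \<le> y ^ 3 * (1 / \<tau>\<^sub>0 + 1 / \<tau>\<^sub>0\<^sup>2)"
    proof -
      have "1 * (1 / \<tau>) \<le> y ^ 3 * (1 / \<tau>\<^sub>0)"
        using y inv pos by (intro mult_mono) auto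
      moreover have "y\<^sup>2 * (1 / \<tau>\<^sup>2) \<le> y ^ 3 * (1 / \<tau>\<^sub>0\<^sup>2)"
        using y inv pos power_increasing[of 2 3 y] by (intro mult_mono) auto
      ultimately show ?thesis by (simp add: distrib_left)
    qed
    ultimately have B: "\<bar>y * (1 / \<tau>)\<bar> \<le> y ^ 3 * (1 / \<tau>\<^sub>0 + 1 / \<tau>\<^sub>0\<^sup>2)"
      "\<bar>1 / \<tau> - y\<^sup>2 * (1 / \<tau>\<^sup>2)\<bar> \<le> y ^ 3 * (1 / \<tau>\<^sub>0 + 1 / \<tau>\<^sub>0\<^sup>2)"
      using pos by (auto simp: abs_le_iff intro: order_trans[rotated])
    have main: "\<bar>gauss_kernel y \<tau> * b\<bar> \<le> G * (1 / \<tau>\<^sub>0 + 1 / \<tau>\<^sub>0\<^sup>2) / y"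
      if "\<bar>b\<bar> \<le> y ^ 3 * (1 / \<tau>\<^sub>0 + 1 / \<tau>\<^sub>0\<^sup>2)" for b
    proof -
      have "\<bar>gauss_kernel y \<tau> * b\<bar> \<le> G / y ^ 4 * (y ^ 3 * (1 / \<tau>\<^sub>0 + 1 / \<tau>\<^sub>0\<^sup>2))"
        unfolding abs_mult using that gk G0 pos by (intro mult_mono) auto
      also have "\<dots> = G * (1 / \<tau>\<^sub>0 + 1 / \<tau>\<^sub>0\<^sup>2) / y"
        using pos by (simp add: power4_eq_xxxx power3_eq_cube)
      finally show ?thesis .
    qed
    show ?thesis
      using main[OF B(1)] main[OF B(2)] by (simp add: dipole_def dipole_y_def)
  qed
  then show ?thesis
    using G0 assms by (intro exI[of _ "G * (1 / \<tau>\<^sub>0 + 1 / \<tau>\<^sub>0\<^sup>2)"]) auto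
qed

text \<open>
  Together with the first moment this says that \<open>dipole y \<tau>\<close> acts on functions of \<open>y\<close> that vanish at
  \<open>0\<close> like the derivative at \<open>0\<close>, with quadratic errors dying out as \<open>\<tau>\<close> tends to \<open>0\<close>.
\<close>
lemma dipole_second_moment:
  assumes "0 < \<tau>" "0 \<le> R"
  shows "integral {0..R} (\<lambda>y. y\<^sup>2 * dipole y \<tau>) \<le> 2 * sqrt (2 * \<tau> / pi)"
proof -
  have "((\<lambda>y. - (y\<^sup>2 + 2 * \<tau>) * gauss_kernel y \<tau>) has_real_derivative y\<^sup>2 * dipole y \<tau>) (at y within {0..R})" for y
    using assms gauss_kernel_deriv_y[OF assms(1), of y "{0..R}"]
    by (auto intro!: derivative_eq_intros simp: dipole_def field_simps)
  then have "((\<lambda>y. y\<^sup>2 * dipole y \<tau>) has_integral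
      (- (R\<^sup>2 + 2 * \<tau>) * gauss_kernel R \<tau> - (- (0\<^sup>2 + 2 * \<tau>) * gauss_kernel 0 \<tau>))) {0..R}"
    using assms by (intro fundamental_theorem_of_calculus)
      (auto simp: has_real_derivative_iff_has_vector_derivative[symmetric])
  moreover have "0 \<le> (R\<^sup>2 + 2 * \<tau>) * gauss_kernel R \<tau>"
    using gauss_kernel_pos[OF assms(1), of R] assms(1)
    by (intro mult_nonneg_nonneg add_nonneg_nonneg) auto
  then have "- (R\<^sup>2 + 2 * \<tau>) * gauss_kernel R \<tau> \<le> 0"
    by linarith
  ultimately have "integral {0..R} (\<lambda>y. y\<^sup>2 * dipole y \<tau>) \<le> 2 * (\<tau> * gauss_kernel 0 \<tau>)"
    by (simp add: integral_unique)
  also have "\<tau> * gauss_kernel 0 \<tau> = sqrt (\<tau>\<^sup>2) * sqrt (2 / (pi * \<tau>))"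
    using assms by (simp add: gauss_kernel_def)
  also have "\<dots> = sqrt (2 * \<tau> / pi)"
    unfolding real_sqrt_mult[symmetric] using assms by (simp add: power2_eq_square)
  finally show ?thesis .
qed

lemma gauss_second_moment:
  "((\<lambda>z. integral {0..z} (\<lambda>x::real. exp (- x\<^sup>2) * x\<^sup>2)) \<longlongrightarrow> sqrt pi / 4) at_top"
proof -
  let ?f = "\<lambda>x::real. exp (- x\<^sup>2) * x\<^sup>2"
  have g: "has_bochner_integral lborel (\<lambda>x::real. indicator {0..} x *\<^sub>R ?f x) (sqrt pi / 4)"
    using gaussian_moment_even_pos[of 1] by (simp add: fact_numeral)
  have "((\<lambda>z. LINT x|lborel. indicator {..z} x *\<^sub>R (indicator {0..} x *\<^sub>R ?f x)) \<longlongrightarrow>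
      (LINT x|lborel. indicator {0..} x *\<^sub>R ?f x)) at_top"
    by (rule tendsto_integral_at_top) (use g in \<open>auto simp: has_bochner_integral_iff\<close>)
  moreover have "(LINT x|lborel. indicator {..z} x *\<^sub>R (indicator {0..} x *\<^sub>R ?f x)) = integral {0..z} ?f" for z
  proof -
    have "set_integrable lborel {0..z} ?f"
      by (intro borel_integrable_atLeastAtMost' continuous_intros)
    then have "(LINT x:{0..z}|lborel. ?f x) = integral {0..z} ?f"
      by (rule set_borel_integral_eq_integral)
    moreover have "indicator {..z} x *\<^sub>R (indicator {0..} x *\<^sub>R ?f x) = indicator {0..z} x *\<^sub>R ?f x" for x
      by (auto simp: indicator_def)
    ultimately show ?thesis by (simp only: set_lebesgue_integral_def)
  qed
  ultimately show ?thesis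
    by (simp only: has_bochner_integral_integral_eq[OF g])
qed

text \<open>
  Substituting \<open>y = x sqrt (2\<tau>)\<close> turns the integral into a truncation of the second moment of the
  Gaussian, over an interval that exhausts the half-line as \<open>\<tau>\<close> tends to \<open>0\<close>.
\<close>
lemma dipole_first_moment:
  assumes "0 < R"
  shows "\<And>\<tau>. 0 < \<tau> \<Longrightarrow> integral {0..R} (\<lambda>y. y * dipole y \<tau>) \<le> 1"
    and "((\<lambda>\<tau>. integral {0..R} (\<lambda>y. y * dipole y \<tau>)) \<longlongrightarrow> 1) (at_right 0)"
proof -
  let ?f = "\<lambda>x::real. exp (- x\<^sup>2) * x\<^sup>2"
  define P where "P z = integral {0..z} ?f" for z
  have P_lim: "(P \<longlongrightarrow> sqrt pi / 4) at_top"
    unfolding P_def by (rule gauss_second_moment)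
  have int: "?f integrable_on {0..z}" for z
    by (intro integrable_continuous_real continuous_intros)
  have P_mono: "P a \<le> P b" if "a \<le> b" for a b
    unfolding P_def using that by (intro integral_subset_le int) auto
  have eq: "integral {0..R} (\<lambda>y. y * dipole y \<tau>) = 4 / sqrt pi * P (R / sqrt (2 * \<tau>))" if "0 < \<tau>" for \<tau>
  proof -
    have P': "(P has_real_derivative ?f z) (at z within {0..})" if "0 \<le> z" for z
    proof -
      have "(P has_vector_derivative ?f z) (at z within {0..z + 1})"
        unfolding P_def using that by (intro integral_has_vector_derivative) (auto intro!: continuous_intros)
      moreover have "at z within {0..z + 1} = at z within {0..}"
        by (rule at_within_nhd[of z "{..<z + 1}"]) auto
      ultimately show ?thesis by (simp add: has_real_derivative_iff_has_vector_derivative)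
    qed
    have "((\<lambda>y. y * dipole y \<tau>) has_integral
        (4 / sqrt pi * P (R / sqrt (2 * \<tau>)) - 4 / sqrt pi * P (0 / sqrt (2 * \<tau>)))) {0..R}"
    proof (rule fundamental_theorem_of_calculus)
      fix y assume y: "y \<in> {0..R}"
      have "((\<lambda>y. P (y / sqrt (2 * \<tau>))) has_real_derivative ?f (y / sqrt (2 * \<tau>)) * (1 / sqrt (2 * \<tau>))) (at y within {0..R})"
      proof -
        have "((\<lambda>y. y / sqrt (2 * \<tau>)) has_real_derivative 1 / sqrt (2 * \<tau>)) (at y within {0..R})"
          by (intro DERIV_cdivide DERIV_ident)
        moreover have "(\<lambda>y. y / sqrt (2 * \<tau>)) ` {0..R} \<subseteq> {0..}" "0 \<le> y / sqrt (2 * \<tau>)"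
          using y that by auto
        ultimately show ?thesis
          using DERIV_image_chain[of P _ "\<lambda>y. y / sqrt (2 * \<tau>)" y "{0..R}"] DERIV_subset[OF P']
          unfolding o_def by blast
      qed
      then have "((\<lambda>y. 4 / sqrt pi * P (y / sqrt (2 * \<tau>))) has_real_derivative
          4 / sqrt pi * (?f (y / sqrt (2 * \<tau>)) * (1 / sqrt (2 * \<tau>)))) (at y within {0..R})"
        by (rule DERIV_cmult)
      also have "4 / sqrt pi * (?f (y / sqrt (2 * \<tau>)) * (1 / sqrt (2 * \<tau>))) = y * dipole y \<tau>"
      proof -
        have "sqrt (2 / (pi * \<tau>)) = 4 / sqrt pi * (1 / (2 * sqrt (2 * \<tau>)))"
          using that by (simp add: real_sqrt_mult real_sqrt_divide field_simps)
        moreover have "(y / sqrt (2 * \<tau>))\<^sup>2 = y\<^sup>2 / (2 * \<tau>)"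
          using that by (simp add: power_divide)
        moreover have "4 / p * (E * (y\<^sup>2 / (2 * \<tau>)) * (1 / r)) = y * (4 / p * (1 / (2 * r)) * E * (y / \<tau>))" for p r E
          by (simp add: power2_eq_square mult_ac)
        ultimately show ?thesis
          by (simp only: dipole_def gauss_kernel_def)
      qed
      finally show "((\<lambda>y. 4 / sqrt pi * P (y / sqrt (2 * \<tau>))) has_vector_derivative y * dipole y \<tau>) (at y within {0..R})"
        by (simp add: has_real_derivative_iff_has_vector_derivative)
    qed (use assms in simp)
    then show ?thesis by (simp add: integral_unique P_def)
  qed
  have P_le: "P z \<le> sqrt pi / 4" for z
    by (rule tendsto_lowerbound[OF P_lim]) (auto intro!: eventually_mono[OF eventually_ge_at_top[of z]] P_mono)
  show "integral {0..R} (\<lambda>y. y * dipole y \<tau>) \<le> 1" if "0 < \<tau>" for \<tau>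
    unfolding eq[OF that] using P_le[of "R / sqrt (2 * \<tau>)"] by (simp add: field_simps)
  have "filterlim (\<lambda>\<tau>. R / sqrt (2 * \<tau>)) at_top (at_right 0)"
  proof -
    have "((\<lambda>\<tau>. sqrt (2 * \<tau>)) \<longlongrightarrow> sqrt (2 * 0)) (at_right 0)"
      by (intro tendsto_intros)
    then have "filterlim (\<lambda>\<tau>. inverse (sqrt (2 * \<tau>))) at_top (at_right 0)"
      by (intro filterlim_inverse_at_top) (auto simp: eventually_at_filter)
    from filterlim_tendsto_pos_mult_at_top[OF tendsto_const assms this] show ?thesis
      by (simp add: divide_inverse)
  qed
  then have "((\<lambda>\<tau>. 4 / sqrt pi * P (R / sqrt (2 * \<tau>))) \<longlongrightarrow> 4 / sqrt pi * (sqrt pi / 4)) (at_right 0)"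
    by (intro tendsto_intros filterlim_compose[OF P_lim])
  then have "((\<lambda>\<tau>. 4 / sqrt pi * P (R / sqrt (2 * \<tau>))) \<longlongrightarrow> 1) (at_right 0)"
    by simp
  then show "((\<lambda>\<tau>. integral {0..R} (\<lambda>y. y * dipole y \<tau>)) \<longlongrightarrow> 1) (at_right 0)"
    by (rule Lim_transform_eventually) (auto simp: eq eventually_at_right_less eventually_at_filter)
qed

section \<open>The flux into an infinite tooth\<close>

context heat_flow
begin

text \<open>
  The half-line is cut at \<open>R\<close>. Subtracting the dipole reflected at \<open>R\<close> makes the test function vanish
  there, so the flux \<open>\<phi>y R s\<close>, for which no bound in \<open>R\<close> is known, drops out of Green's identity; what
  remains at \<open>R\<close> involves \<open>\<phi> R s\<close> only, which is bounded.
\<close>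
definition reflected_pairing :: "real \<Rightarrow> real \<Rightarrow> real \<Rightarrow> real" where
  "reflected_pairing R t s = integral {0..R} (\<lambda>y. \<phi> y s * (dipole y (t - s) - dipole (2 * R - y) (t - s)))
     - \<phi> 0 s * gauss_kernel 0 (t - s)"

lemma image_pairing_bound:
  assumes J: "J = {0..}" and R: "0 < R" and \<tau>: "0 < \<tau>" and s: "0 \<le> s"
  shows "\<bar>integral {0..R} (\<lambda>y. \<phi> y s * dipole (2 * R - y) \<tau>)\<bar> \<le> M * gauss_kernel R \<tau>"
proof -
  have "\<bar>integral {0..R} (\<lambda>y. \<phi> y s * dipole (2 * R - y) \<tau>)\<bar> \<le> integral {0..R} (\<lambda>y. M * dipole (2 * R - y) \<tau>)"
    unfolding real_norm_def[symmetric]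
  proof (rule integral_norm_bound_integral)
    show "norm (\<phi> y s * dipole (2 * R - y) \<tau>) \<le> M * dipole (2 * R - y) \<tau>" if "y \<in> {0..R}" for y
      using bounded[of y s] s J dipole_nonneg[OF \<tau>, of "2 * R - y"] that
      by (simp add: abs_mult mult_right_mono)
  qed (use J \<tau> s in \<open>auto intro!: integrable_continuous_real continuous_intros\<close>)
  also have "\<dots> = M * (gauss_kernel R \<tau> - gauss_kernel (2 * R) \<tau>)"
    using reflected_dipole_mass[OF \<tau>, of R] R by (simp add: integral_unique)
  also have "\<dots> \<le> M * gauss_kernel R \<tau>"
    using M_nonneg gauss_kernel_pos[OF \<tau>, of "2 * R"] by (intro mult_left_mono) auto
  finally show ?thesis .
qed

text \<open>
  As \<open>s\<close> tends to \<open>t\<close> the dipole concentrates at \<open>0\<close> and differentiates there. Writing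
  \<open>\<phi> y s = \<phi> 0 s + p0 * y + error\<close>, the constant is matched by the correction term, the linear part
  gives \<open>p0\<close> times the first moment, and the error is at most \<open>\<epsilon> * y + C * y\<^sup>2\<close>, small against the
  first two moments.
\<close>
lemma reflected_pairing_limit:
  assumes J: "J = {0..}" and R: "0 < R" and t: "0 < t"
  shows "(reflected_pairing R t \<longlongrightarrow> \<phi>y 0 t) (at_left t)"
proof (rule tendstoI)
  fix e :: real assume "0 < e"
  define p0 where "p0 = \<phi>y 0 t"
  have "\<exists>d>0. \<forall>x\<in>J \<times> {0<..}. dist x (0, t) < d \<longrightarrow> dist ((\<lambda>(y, s). \<phi>y y s) x) (\<phi>y 0 t) < e / 2"
    using cont_y[unfolded continuous_on_iff, rule_format, of "(0, t)" "e / 2"] spine t \<open>0 < e\<close> by simp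
  then obtain d where "0 < d" and d: "\<And>y s. y \<in> J \<Longrightarrow> 0 < s \<Longrightarrow> dist (y, s) (0, t) < d \<Longrightarrow> \<bar>\<phi>y y s - p0\<bar> < e / 2"
    by (force simp: p0_def dist_real_def)
  define \<delta> where "\<delta> = d / 3"
  have "0 < \<delta>" using \<open>0 < d\<close> by (simp add: \<delta>_def)
  have near: "\<bar>\<phi>y y s - p0\<bar> \<le> e / 2" if "0 \<le> y" "y \<le> \<delta>" "0 < s" "\<bar>s - t\<bar> \<le> \<delta>" for y s
  proof -
    have "dist (y, s) (0, t) \<le> \<bar>y\<bar> + \<bar>s - t\<bar>"
      unfolding dist_Pair_Pair dist_real_def using sqrt_sum_squares_le_sum_abs[of y "s - t"] by simp
    also have "\<dots> < d" using that \<open>0 < d\<close> by (simp add: \<delta>_def)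
    finally show ?thesis using d[of y s] that J by auto
  qed
  \<comment> \<open>For \<open>y > \<delta>\<close> the error is at most linear in \<open>y\<close>, since \<open>\<phi>\<close> is bounded by \<open>M\<close>, and \<open>y \<le> y\<^sup>2 / \<delta>\<close>.\<close>
  define C where "C = (2 * M / \<delta> + \<bar>p0\<bar>) / \<delta>"
  have "0 \<le> C" using M_nonneg \<open>0 < \<delta>\<close> by (simp add: C_def)
  have taylor: "\<bar>\<phi> y s - \<phi> 0 s - p0 * y\<bar> \<le> e / 2 * y + C * y\<^sup>2"
    if y: "0 \<le> y" and s: "0 < s" "\<bar>s - t\<bar> \<le> \<delta>" for y s
  proof (cases "y \<le> \<delta>")
    case True
    have "norm ((\<phi> y s - p0 * y) - (\<phi> 0 s - p0 * 0)) \<le> e / 2 * norm (y - 0)"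
    proof (rule field_differentiable_bound[where S = "{0..y}" and f = "\<lambda>y. \<phi> y s - p0 * y" and f' = "\<lambda>y. \<phi>y y s - p0"])
      show "((\<lambda>y. \<phi> y s - p0 * y) has_real_derivative \<phi>y z s - p0) (at z within {0..y})" if "z \<in> {0..y}" for z
      proof -
        have "z \<in> J" "{0..y} \<subseteq> J" using that J by auto
        from DERIV_subset[OF deriv_y[OF this(1) s(1)] this(2)] show ?thesis
          by (auto intro!: derivative_eq_intros)
      qed
      show "norm (\<phi>y z s - p0) \<le> e / 2" if "z \<in> {0..y}" for z
        using near[of z s] that True s by auto
    qed (use y in auto)
    moreover have "0 \<le> C * y\<^sup>2" using \<open>0 \<le> C\<close> by simp
    moreover have "\<phi> y s - \<phi> 0 s - p0 * y = (\<phi> y s - p0 * y) - (\<phi> 0 s - p0 * 0)" by simp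
    ultimately show ?thesis using y by (simp only: real_norm_def) simp
  next
    case False
    have "\<bar>\<phi> y s - \<phi> 0 s - p0 * y\<bar> \<le> 2 * M + \<bar>p0\<bar> * y"
      using bounded[of y s] bounded[OF spine, of s] y s J abs_mult[of p0 y] by auto
    also have "\<dots> \<le> 2 * M / \<delta> * y + \<bar>p0\<bar> * y"
    proof -
      have "2 * M / \<delta> * \<delta> \<le> 2 * M / \<delta> * y"
        using False M_nonneg \<open>0 < \<delta>\<close> by (intro mult_left_mono) auto
      then show ?thesis using \<open>0 < \<delta>\<close> by simp
    qed
    also have "\<dots> = (2 * M / \<delta> + \<bar>p0\<bar>) * (1 * y)" by (simp add: algebra_simps)
    also have "\<dots> \<le> (2 * M / \<delta> + \<bar>p0\<bar>) * (y / \<delta> * y)"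
      using False M_nonneg \<open>0 < \<delta>\<close> by (intro mult_left_mono mult_right_mono) auto
    also have "\<dots> = C * y\<^sup>2" by (simp add: C_def power2_eq_square)
    finally show ?thesis using y \<open>0 < e\<close> by (simp add: add_increasing)
  qed
  define m where "m \<tau> = integral {0..R} (\<lambda>y. y * dipole y \<tau>)" for \<tau>
  define \<beta> where "\<beta> s = \<bar>p0\<bar> * \<bar>m (t - s) - 1\<bar> + (2 * C + 4 * M / R\<^sup>2) * sqrt (2 * (t - s) / pi)" for s
  have "filterlim (\<lambda>s. t - s) (at_right 0) (at_left t)"
    unfolding filterlim_at
    by (auto intro!: tendsto_eq_intros simp: eventually_at_filter)
  then have "((\<lambda>s. m (t - s)) \<longlongrightarrow> 1) (at_left t)"
    using filterlim_compose[OF dipole_first_moment(2)[OF R]] by (simp add: m_def)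
  then have "(\<beta> \<longlongrightarrow> \<bar>p0\<bar> * \<bar>1 - 1\<bar> + (2 * C + 4 * M / R\<^sup>2) * sqrt (2 * (t - t) / pi)) (at_left t)"
    unfolding \<beta>_def by (intro tendsto_intros) auto
  then have "(\<beta> \<longlongrightarrow> 0) (at_left t)" by simp
  then have "\<forall>\<^sub>F s in at_left t. \<beta> s < e / 2"
    by (rule order_tendstoD) (use \<open>0 < e\<close> in simp)
  moreover have "\<forall>\<^sub>F s in at_left t. s \<in> {max 0 (t - \<delta>)<..<t}"
    using t \<open>0 < \<delta>\<close> by (intro eventually_at_leftI[of "max 0 (t - \<delta>)"]) auto
  ultimately show "\<forall>\<^sub>F s in at_left t. dist (reflected_pairing R t s) (\<phi>y 0 t) < e"
  proof eventually_elim
    case (elim s)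
    define \<tau> where "\<tau> = t - s"
    have s: "0 < s" "\<bar>s - t\<bar> \<le> \<delta>" and \<tau>: "0 < \<tau>" using elim by (auto simp: \<tau>_def)
    have int: "r integrable_on {0..R}" if "continuous_on {0..R} r" for r :: "real \<Rightarrow> real"
      using that by (rule integrable_continuous_real)
    define I where "I = integral {0..R} (\<lambda>y. (\<phi> y s - \<phi> 0 s - p0 * y) * dipole y \<tau>)"
    define I' where "I' = integral {0..R} (\<lambda>y. \<phi> y s * dipole (2 * R - y) \<tau>)"
    have cont_phi_s: "continuous_on {0..R} (\<lambda>y. \<phi> y s)"
      using J s by (intro continuous_intros) auto
    note c [continuous_intros] = cont_phi_s
    have split: "reflected_pairing R t s = I + p0 * m \<tau> - \<phi> 0 s * gauss_kernel R \<tau> - I'"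
    proof -
      have "integral {0..R} (\<lambda>y. \<phi> y s * (dipole y \<tau> - dipole (2 * R - y) \<tau>))
          = integral {0..R} (\<lambda>y. ((\<phi> y s - \<phi> 0 s - p0 * y) * dipole y \<tau> + p0 * (y * dipole y \<tau>)
              + \<phi> 0 s * dipole y \<tau>) - \<phi> y s * dipole (2 * R - y) \<tau>)"
        by (rule integral_cong) (simp add: algebra_simps)
      also have "\<dots> = integral {0..R} (\<lambda>y. (\<phi> y s - \<phi> 0 s - p0 * y) * dipole y \<tau> + p0 * (y * dipole y \<tau>)
              + \<phi> 0 s * dipole y \<tau>) - I'"
        unfolding I'_def using \<tau> by (intro integral_diff int continuous_intros) auto
      also have "integral {0..R} (\<lambda>y. (\<phi> y s - \<phi> 0 s - p0 * y) * dipole y \<tau> + p0 * (y * dipole y \<tau>)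
              + \<phi> 0 s * dipole y \<tau>)
          = integral {0..R} (\<lambda>y. (\<phi> y s - \<phi> 0 s - p0 * y) * dipole y \<tau> + p0 * (y * dipole y \<tau>))
            + integral {0..R} (\<lambda>y. \<phi> 0 s * dipole y \<tau>)"
        using \<tau> by (intro integral_add int continuous_intros) auto
      also have "integral {0..R} (\<lambda>y. (\<phi> y s - \<phi> 0 s - p0 * y) * dipole y \<tau> + p0 * (y * dipole y \<tau>))
          = I + integral {0..R} (\<lambda>y. p0 * (y * dipole y \<tau>))"
        unfolding I_def using \<tau> by (intro integral_add int continuous_intros) auto
      also have "integral {0..R} (\<lambda>y. \<phi> 0 s * dipole y \<tau>) = \<phi> 0 s * (gauss_kernel 0 \<tau> - gauss_kernel R \<tau>)"
        using dipole_mass[OF \<tau>, of 0 R] R by (simp add: integral_unique)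
      also have "integral {0..R} (\<lambda>y. p0 * (y * dipole y \<tau>)) = p0 * m \<tau>"
        by (simp add: m_def)
      finally have pairing: "integral {0..R} (\<lambda>y. \<phi> y s * (dipole y \<tau> - dipole (2 * R - y) \<tau>))
          = I + p0 * m \<tau> + \<phi> 0 s * (gauss_kernel 0 \<tau> - gauss_kernel R \<tau>) - I'" .
      show ?thesis
        unfolding reflected_pairing_def \<tau>_def[symmetric] pairing by (simp add: algebra_simps)
    qed
    have "\<bar>I\<bar> \<le> integral {0..R} (\<lambda>y. e / 2 * (y * dipole y \<tau>) + C * (y\<^sup>2 * dipole y \<tau>))"
      unfolding I_def real_norm_def[symmetric]
    proof (rule integral_norm_bound_integral)
      show "norm ((\<phi> y s - \<phi> 0 s - p0 * y) * dipole y \<tau>) \<le> e / 2 * (y * dipole y \<tau>) + C * (y\<^sup>2 * dipole y \<tau>)"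
        if "y \<in> {0..R}" for y
      proof -
        have "norm ((\<phi> y s - \<phi> 0 s - p0 * y) * dipole y \<tau>) \<le> (e / 2 * y + C * y\<^sup>2) * dipole y \<tau>"
          using taylor[of y s] s dipole_nonneg[OF \<tau>, of y] that by (simp add: abs_mult mult_right_mono)
        then show ?thesis by (simp add: algebra_simps)
      qed
    qed (use \<tau> in \<open>auto intro!: int continuous_intros\<close>)
    also have "\<dots> = e / 2 * m \<tau> + C * integral {0..R} (\<lambda>y. y\<^sup>2 * dipole y \<tau>)"
      unfolding m_def using \<tau> by (subst integral_add) (auto intro!: int continuous_intros)
    also have "\<dots> \<le> e / 2 * 1 + C * (2 * sqrt (2 * \<tau> / pi))"
      unfolding m_def using \<open>0 < e\<close> \<open>0 \<le> C\<close> R \<tau>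
      by (intro add_mono mult_left_mono dipole_first_moment dipole_second_moment) auto
    finally have I: "\<bar>I\<bar> \<le> e / 2 + C * (2 * sqrt (2 * \<tau> / pi))" by simp
    have I': "\<bar>I'\<bar> \<le> M * gauss_kernel R \<tau>"
      unfolding I'_def using J R \<tau> s by (intro image_pairing_bound) auto
    have "\<bar>\<phi> 0 s * gauss_kernel R \<tau>\<bar> \<le> M * gauss_kernel R \<tau>"
      using bounded[OF spine, of s] s gauss_kernel_pos[OF \<tau>, of R] by (simp add: abs_mult mult_right_mono)
    moreover have "M * gauss_kernel R \<tau> \<le> M * (2 * sqrt (2 * \<tau> / pi) / R\<^sup>2)"
      using M_nonneg by (intro mult_left_mono gauss_kernel_far \<tau> R)
    moreover have "\<bar>p0 * m \<tau> - p0\<bar> = \<bar>p0\<bar> * \<bar>m \<tau> - 1\<bar>"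
      by (simp add: abs_mult[symmetric] algebra_simps)
    moreover have "\<bar>I + p0 * m \<tau> - \<phi> 0 s * gauss_kernel R \<tau> - I' - p0\<bar>
        \<le> \<bar>I\<bar> + \<bar>p0 * m \<tau> - p0\<bar> + \<bar>\<phi> 0 s * gauss_kernel R \<tau>\<bar> + \<bar>I'\<bar>"
      by linarith
    ultimately have "\<bar>reflected_pairing R t s - p0\<bar>
        \<le> (e / 2 + C * (2 * sqrt (2 * \<tau> / pi))) + \<bar>p0\<bar> * \<bar>m \<tau> - 1\<bar>
          + M * (2 * sqrt (2 * \<tau> / pi) / R\<^sup>2) + M * (2 * sqrt (2 * \<tau> / pi) / R\<^sup>2)"
      unfolding split using I I' by linarith
    also have "\<dots> = e / 2 + \<beta> s"
      by (simp add: \<beta>_def \<tau>_def[symmetric] algebra_simps)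
    also have "\<dots> < e" using elim by simp
    finally show ?case by (simp add: dist_real_def p0_def)
  qed
qed

lemma reflected_pairing_continuous:
  assumes J: "J = {0..}" and R: "0 < R" and t: "0 < t"
  shows "continuous_on {0..t} (\<lambda>s. if s = t then \<phi>y 0 t else reflected_pairing R t s)"
  unfolding continuous_on_eq_continuous_within
proof
  fix s assume s: "s \<in> {0..t}"
  let ?F = "\<lambda>s. if s = t then \<phi>y 0 t else reflected_pairing R t s"
  show "continuous (at s within {0..t}) ?F"
  proof (cases "s = t")
    case True
    have "(?F \<longlongrightarrow> \<phi>y 0 t) (at_left t)"
      using reflected_pairing_limit[OF assms]
      by (rule Lim_transform_eventually) (auto simp: eventually_at_filter)
    moreover have "at t within {0..t} = at_left t"
      using t by (simp add: at_within_Icc_at_left)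
    ultimately show ?thesis using True by (simp add: continuous_within)
  next
    case False
    have "continuous_on {0..<t} (reflected_pairing R t)"
      unfolding reflected_pairing_def
    proof (intro continuous_on_diff pairing_continuous)
      show "continuous_on ({0..<t} \<times> {0..R}) (\<lambda>(s, y). dipole y (t - s) - dipole (2 * R - y) (t - s))"
        unfolding split_beta by (intro continuous_intros) auto
      show "continuous_on {0..<t} (\<lambda>s. \<phi> 0 s * gauss_kernel 0 (t - s))"
        using spine by (intro continuous_intros) auto
    qed (use J in auto)
    then have "continuous_on {0..<t} ?F"
      by (rule continuous_on_eq) auto
    then have "continuous (at s within {0..<t}) ?F"
      using s False by (simp add: continuous_on_eq_continuous_within)
    moreover have "at s within {0..<t} = at s within {0..t}"
      by (rule at_within_nhd[of s "{..<t}"]) (use s False in auto)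
    ultimately show ?thesis by simp
  qed
qed

text \<open>
  The terms \<open>\<phi> 0 s * dipole_y 0 (t - s) / 2\<close> from Green's identity and from differentiating the
  correction cancel. Apart from the integrand only terms at distance \<open>R\<close> and \<open>2 * R\<close> are left.
\<close>
lemma reflected_pairing_derivative:
  assumes J: "J = {0..}" and R: "0 < R" and s: "0 < s" "s < t"
  shows "(reflected_pairing R t has_real_derivative
      (- (gauss_kernel 0 (t - s) * (\<phi>yy 0 s / 2))
        - \<phi> R s * dipole_y R (t - s) + \<phi>y 0 s * dipole (2 * R) (t - s) / 2
        + \<phi> 0 s * dipole_y (2 * R) (t - s) / 2)) (at s)"
proof -
  define q where "q y s = dipole y (t - s) - dipole (2 * R - y) (t - s)" for y s
  define qy where "qy y s = dipole_y y (t - s) + dipole_y (2 * R - y) (t - s)" for y s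
  define qyy where "qyy y s = dipole_yy y (t - s) - dipole_yy (2 * R - y) (t - s)" for y s
  have ds: "((\<lambda>s. t - s) has_real_derivative -1) (at s)" for s
    by (auto intro!: derivative_eq_intros)
  have dr: "((\<lambda>y. 2 * R - y) has_real_derivative -1) (at y)" for y
    by (auto intro!: derivative_eq_intros)
  have "((\<lambda>s. integral {0..R} (\<lambda>y. \<phi> y s * q y s)) has_real_derivative
      ((\<phi>y R s * q R s - \<phi> R s * qy R s) - (\<phi>y 0 s * q 0 s - \<phi> 0 s * qy 0 s)) / 2) (at s)"
  proof (rule pairing_derivative[where t = t and qyy = qyy])
    fix y s :: real assume s: "0 < s" "s < t"
    then have \<tau>: "0 < t - s" by simp
    show "((\<lambda>s. q y s) has_real_derivative - (qyy y s / 2)) (at s)"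
      unfolding q_def qyy_def
      using DERIV_diff[OF DERIV_chain2[where f = "dipole y", OF dipole_heat[OF \<tau>] ds]
          DERIV_chain2[where f = "dipole (2 * R - y)", OF dipole_heat[OF \<tau>] ds]]
      by (simp add: diff_divide_distrib)
    show "((\<lambda>y. q y s) has_real_derivative qy y s) (at y)"
      unfolding q_def qy_def
      using DERIV_diff[OF dipole_deriv_y[OF \<tau>, of y UNIV]
          DERIV_chain2[where f = "\<lambda>y. dipole y (t - s)", OF dipole_deriv_y[OF \<tau>] dr]]
      by simp
    show "((\<lambda>y. qy y s) has_real_derivative qyy y s) (at y)"
      unfolding qy_def qyy_def
      using DERIV_add[OF dipole_deriv_yy[OF \<tau>, of y UNIV]
          DERIV_chain2[where f = "\<lambda>y. dipole_y y (t - s)", OF dipole_deriv_yy[OF \<tau>] dr]]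
      by simp
  next
    show "continuous_on ({0<..<t} \<times> {0..R}) (\<lambda>(s, y). q y s)"
      "continuous_on ({0<..<t} \<times> {0..R}) (\<lambda>(s, y). qyy y s)"
      unfolding split_beta q_def qyy_def by (intro continuous_intros; auto)+
  qed (use J R s in auto)
  moreover have "((\<lambda>s. gauss_kernel 0 (t - s)) has_real_derivative (dipole_y 0 (t - s) / 2)) (at s)"
    using DERIV_chain2[where f = "gauss_kernel 0", OF gauss_kernel_deriv_time ds] s by simp
  moreover have "((\<lambda>s. \<phi> 0 s) has_real_derivative \<phi>yy 0 s / 2) (at s)"
    by (rule heat[OF spine s(1)])
  ultimately have "((\<lambda>s. integral {0..R} (\<lambda>y. \<phi> y s * q y s) - \<phi> 0 s * gauss_kernel 0 (t - s)) has_real_derivative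
      ((\<phi>y R s * q R s - \<phi> R s * qy R s) - (\<phi>y 0 s * q 0 s - \<phi> 0 s * qy 0 s)) / 2
      - (\<phi> 0 s * (dipole_y 0 (t - s) / 2) + \<phi>yy 0 s / 2 * gauss_kernel 0 (t - s))) (at s)"
    by (intro DERIV_diff DERIV_mult')
  moreover have "q R s = 0" "qy R s = 2 * dipole_y R (t - s)" "q 0 s = - dipole (2 * R) (t - s)"
    "qy 0 s = dipole_y 0 (t - s) + dipole_y (2 * R) (t - s)"
    by (simp_all add: q_def qy_def dipole_def)
  ultimately show ?thesis
    unfolding reflected_pairing_def[abs_def] q_def
    by (elim DERIV_cong) (simp add: q_def[symmetric] field_simps)
qed

text \<open>
  Moving the cut changes the pairing by the mass of the dipole beyond \<open>R\<close> and by the two reflected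
  dipoles; each is at most \<open>gauss_kernel R\<close>, and \<open>gauss_kernel_far\<close> makes this uniform in time.
\<close>
lemma reflected_pairing_Cauchy:
  assumes J: "J = {0..}" and R: "0 < R" "R \<le> R'" and s: "0 \<le> s" "s < t"
  shows "\<bar>reflected_pairing R' t s - reflected_pairing R t s\<bar> \<le> 6 * M * sqrt (2 * t / pi) / R\<^sup>2"
proof -
  define \<tau> where "\<tau> = t - s"
  have \<tau>: "0 < \<tau>" "\<tau> \<le> t" using s by (auto simp: \<tau>_def)
  have int: "r integrable_on {a..b}" if "continuous_on {a..b} r" for r :: "real \<Rightarrow> real" and a b
    using that by (rule integrable_continuous_real)
  have cont_phi_s [continuous_intros]: "continuous_on {a..b} (\<lambda>y. \<phi> y s)" if "0 \<le> a" for a b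
    using J s that by (intro continuous_intros) auto
  define I' where "I' R = integral {0..R} (\<lambda>y. \<phi> y s * dipole (2 * R - y) \<tau>)" for R
  define I where "I a b = integral {a..b} (\<lambda>y. \<phi> y s * dipole y \<tau>)" for a b
  have split: "reflected_pairing r t s = I 0 r - I' r - \<phi> 0 s * gauss_kernel 0 \<tau>" if "0 < r" for r
  proof -
    have "integral {0..r} (\<lambda>y. \<phi> y s * (dipole y \<tau> - dipole (2 * r - y) \<tau>)) = I 0 r - I' r"
      unfolding I_def I'_def right_diff_distrib using \<tau>
      by (intro integral_diff int continuous_intros) auto
    then show ?thesis by (simp add: reflected_pairing_def \<tau>_def)
  qed
  have I': "\<bar>I' r\<bar> \<le> M * gauss_kernel r \<tau>" if "0 < r" for r
    unfolding I'_def using J that \<tau> s by (intro image_pairing_bound) auto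
  have I: "\<bar>I R R'\<bar> \<le> M * gauss_kernel R \<tau>"
  proof -
    have "\<bar>I R R'\<bar> \<le> integral {R..R'} (\<lambda>y. M * dipole y \<tau>)"
      unfolding I_def real_norm_def[symmetric]
    proof (rule integral_norm_bound_integral)
      show "norm (\<phi> y s * dipole y \<tau>) \<le> M * dipole y \<tau>" if "y \<in> {R..R'}" for y
        using bounded[of y s] s J R dipole_nonneg[OF \<tau>(1), of y] that
        by (simp add: abs_mult mult_right_mono)
    qed (use \<tau> R in \<open>auto intro!: int continuous_intros\<close>)
    also have "\<dots> = M * (gauss_kernel R \<tau> - gauss_kernel R' \<tau>)"
      using dipole_mass[OF \<tau>(1) R(2)] by (simp add: integral_unique)
    also have "\<dots> \<le> M * gauss_kernel R \<tau>"
      using M_nonneg gauss_kernel_pos[OF \<tau>(1), of R'] by (intro mult_left_mono) auto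
    finally show ?thesis .
  qed
  have "I 0 R + I R R' = I 0 R'"
    unfolding I_def using R \<tau> J s by (intro Henstock_Kurzweil_Integration.integral_combine int continuous_intros) auto
  then have "\<bar>reflected_pairing R' t s - reflected_pairing R t s\<bar> \<le> \<bar>I R R'\<bar> + \<bar>I' R'\<bar> + \<bar>I' R\<bar>"
    using split[of R] split[of R'] R by linarith
  also have "\<dots> \<le> M * gauss_kernel R \<tau> + M * gauss_kernel R' \<tau> + M * gauss_kernel R \<tau>"
    using I I'[of R] I'[of R'] R by linarith
  also have "\<dots> \<le> 3 * (M * gauss_kernel R \<tau>)"
  proof -
    have "gauss_kernel R' \<tau> \<le> gauss_kernel R \<tau>"
      unfolding gauss_kernel_def using R \<tau>
      by (intro mult_left_mono) (auto intro!: divide_right_mono power_mono)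
    then have "M * gauss_kernel R' \<tau> \<le> M * gauss_kernel R \<tau>"
      using M_nonneg by (rule mult_left_mono)
    then show ?thesis by simp
  qed
  also have "\<dots> \<le> 3 * (M * (2 * sqrt (2 * t / pi) / R\<^sup>2))"
  proof (intro mult_left_mono M_nonneg)
    have "gauss_kernel R \<tau> \<le> 2 * sqrt (2 * \<tau> / pi) / R\<^sup>2"
      by (rule gauss_kernel_far[OF \<tau>(1) R(1)])
    also have "\<dots> \<le> 2 * sqrt (2 * t / pi) / R\<^sup>2"
      using \<tau> by (intro divide_right_mono mult_left_mono) (auto intro!: divide_right_mono)
    finally show "gauss_kernel R \<tau> \<le> 2 * sqrt (2 * t / pi) / R\<^sup>2" .
  qed auto
  finally show ?thesis by simp
qed

lemma flux_identity_unbounded_tooth: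
  assumes J: "J = {0..}" and t: "0 < t"
  shows "((\<lambda>s. gauss_kernel 0 (t - s) * (\<phi>yy 0 s / 2)) has_integral - \<phi>y 0 t) {0..t}"
proof -
  \<comment> \<open>At \<open>s = t\<close> the formula degenerates; the prescribed value is its limit.\<close>
  define F where "F n s = (if s = t then \<phi>y 0 t else reflected_pairing (real (Suc n)) t s)" for n s
  \<comment> \<open>The boundary terms at the cut.\<close>
  define r where "r n s = - (\<phi> (real (Suc n)) s * dipole_y (real (Suc n)) (t - s))
    + \<phi>y 0 s * dipole (2 * real (Suc n)) (t - s) / 2
    + \<phi> 0 s * dipole_y (2 * real (Suc n)) (t - s) / 2" for n s
  have "((\<lambda>s. - (gauss_kernel 0 (t - s) * (\<phi>yy 0 s / 2))) has_integral \<phi>y 0 t - 0) {0..t}"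
  proof (rule has_integral_of_locally_uniform_derivatives[where F = F
        and D = "\<lambda>n s. - (gauss_kernel 0 (t - s) * (\<phi>yy 0 s / 2)) + r n s"])
    show "continuous_on {0..t} (F n)" for n
      unfolding F_def by (rule reflected_pairing_continuous[OF J _ t]) simp
    show "(F n has_real_derivative - (gauss_kernel 0 (t - s) * (\<phi>yy 0 s / 2)) + r n s) (at s)"
      if s: "0 < s" "s < t" for n s
    proof (rule has_field_derivative_transform_within_open[where S = "{..<t}"])
      show "(reflected_pairing (real (Suc n)) t has_real_derivative
          - (gauss_kernel 0 (t - s) * (\<phi>yy 0 s / 2)) + r n s) (at s)"
        using reflected_pairing_derivative[OF J _ s, of "real (Suc n)"]
        by (simp add: r_def algebra_simps)
    qed (use s in \<open>auto simp: F_def\<close>)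
    show "(\<lambda>n. F n 0) \<longlonglongrightarrow> 0"
    proof -
      have "reflected_pairing R t 0 = 0" for R
        using J spine initial unfolding reflected_pairing_def
        by (auto intro!: integral_unique has_integral_eq[OF _ has_integral_0])
      then show ?thesis using t by (simp add: F_def)
    qed
    show "(\<lambda>n. F n t) \<longlonglongrightarrow> \<phi>y 0 t"
      by (simp add: F_def)
    show "uniformly_Cauchy_on {0..t} F"
    proof (rule uniformly_Cauchy_onI')
      fix e :: real assume "0 < e"
      define A where "A = 6 * M * sqrt (2 * t / pi)"
      have "0 \<le> A" using M_nonneg t by (simp add: A_def)
      obtain N where N: "A / e < real N" using reals_Archimedean2 by blast
      have "dist (F m s) (F n s) < e" if s: "s \<in> {0..t}" and mn: "N \<le> m" "m < n" for s m n
      proof (cases "s = t")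
        case False
        have "dist (F m s) (F n s) = \<bar>reflected_pairing (real (Suc n)) t s - reflected_pairing (real (Suc m)) t s\<bar>"
          using False by (simp add: F_def dist_real_def abs_minus_commute)
        also have "\<dots> \<le> A / (real (Suc m))\<^sup>2"
          unfolding A_def using s False mn by (intro reflected_pairing_Cauchy J) auto
        also have "\<dots> \<le> A / real (Suc m)"
          using \<open>0 \<le> A\<close> by (intro divide_left_mono) (auto simp: power2_eq_square)
        also have "\<dots> < e"
        proof -
          have "A / e < real (Suc m)" using N mn by linarith
          then show ?thesis using \<open>0 < e\<close> by (simp add: field_simps)
        qed
        finally show ?thesis .
      qed (use \<open>0 < e\<close> in \<open>simp add: F_def\<close>)
      then show "\<exists>N. \<forall>s\<in>{0..t}. \<forall>m\<ge>N. \<forall>n>m. dist (F m s) (F n s) < e" by blast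
    qed
    show "uniform_limit {a..b} (\<lambda>n s. - (gauss_kernel 0 (t - s) * (\<phi>yy 0 s / 2)) + r n s)
        (\<lambda>s. - (gauss_kernel 0 (t - s) * (\<phi>yy 0 s / 2))) sequentially" if ab: "0 < a" "a < b" "b < t" for a b
    proof -
      obtain K where K: "0 \<le> K" "\<And>\<tau> y. \<tau> \<in> {t - b..t} \<Longrightarrow> 1 \<le> y \<Longrightarrow> \<bar>dipole y \<tau>\<bar> \<le> K / y"
        "\<And>\<tau> y. \<tau> \<in> {t - b..t} \<Longrightarrow> 1 \<le> y \<Longrightarrow> \<bar>dipole_y y \<tau>\<bar> \<le> K / y"
        using dipole_far[of "t - b" t] ab by auto
      have "{a..b} \<subseteq> {0<..}" using ab by auto
      then obtain C where C: "\<And>s. s \<in> {a..b} \<Longrightarrow> \<bar>\<phi>y 0 s\<bar> \<le> C"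
        using bounded_on_rectangles[of "{0}" "{a..b}"] spine by fastforce
      have r_le: "\<bar>r n s\<bar> \<le> (2 * M + C) * K / real (Suc n)" if s: "s \<in> {a..b}" for n s
      proof -
        let ?R = "real (Suc n)"
        have \<tau>: "t - s \<in> {t - b..t}" using s ab by auto
        have R: "1 \<le> ?R" "1 \<le> 2 * ?R" "K / (2 * ?R) \<le> K / ?R"
          using K(1) by (auto intro: divide_left_mono)
        have b: "\<bar>\<phi> ?R s\<bar> \<le> M" "\<bar>\<phi> 0 s\<bar> \<le> M" "\<bar>\<phi>y 0 s\<bar> \<le> C"
          using bounded[of ?R s] bounded[of 0 s] C[OF s] J s ab by auto
        have d: "\<bar>dipole_y ?R (t - s)\<bar> \<le> K / ?R" "\<bar>dipole (2 * ?R) (t - s)\<bar> \<le> K / ?R"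
          "\<bar>dipole_y (2 * ?R) (t - s)\<bar> \<le> K / ?R"
          using K(2)[OF \<tau> R(2)] K(3)[OF \<tau> R(1)] K(3)[OF \<tau> R(2)] R(3) by linarith+
        have "0 \<le> C" using b(3) by linarith
        have "\<bar>\<phi> ?R s * dipole_y ?R (t - s)\<bar> \<le> M * (K / ?R)"
          "\<bar>\<phi>y 0 s * dipole (2 * ?R) (t - s)\<bar> \<le> C * (K / ?R)"
          "\<bar>\<phi> 0 s * dipole_y (2 * ?R) (t - s)\<bar> \<le> M * (K / ?R)"
          unfolding abs_mult using M_nonneg \<open>0 \<le> C\<close> by (intro mult_mono b d; simp)+
        moreover have "0 \<le> M * (K / ?R)" "0 \<le> C * (K / ?R)"
          using M_nonneg \<open>0 \<le> C\<close> K(1) by simp_all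
        moreover have "\<bar>- a + b / 2 + c / 2\<bar> \<le> 2 * x + y"
          if "\<bar>a\<bar> \<le> x" "\<bar>b\<bar> \<le> y" "\<bar>c\<bar> \<le> x" "0 \<le> x" "0 \<le> y" for a b c x y :: real
          using that by linarith
        ultimately have "\<bar>r n s\<bar> \<le> 2 * (M * (K / ?R)) + C * (K / ?R)"
          unfolding r_def by blast
        also have "\<dots> = (2 * M + C) * K / ?R" by (simp add: algebra_simps add_divide_distrib)
        finally show ?thesis .
      qed
      show ?thesis
      proof (rule uniform_limitI)
        fix e :: real assume "0 < e"
        have "(\<lambda>n. (2 * M + C) * K / real (Suc n)) \<longlonglongrightarrow> 0"
          by (rule LIMSEQ_Suc[OF lim_const_over_n])
        then have "\<forall>\<^sub>F n in sequentially. (2 * M + C) * K / real (Suc n) < e"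
          using \<open>0 < e\<close> by (rule order_tendstoD)
        then show "\<forall>\<^sub>F n in sequentially. \<forall>s\<in>{a..b}. dist (- (gauss_kernel 0 (t - s) * (\<phi>yy 0 s / 2)) + r n s)
            (- (gauss_kernel 0 (t - s) * (\<phi>yy 0 s / 2))) < e"
        proof eventually_elim
          case (elim n)
          show ?case
          proof
            fix s assume "s \<in> {a..b}"
            from r_le[OF this, of n] elim show "dist (- (gauss_kernel 0 (t - s) * (\<phi>yy 0 s / 2)) + r n s)
                (- (gauss_kernel 0 (t - s) * (\<phi>yy 0 s / 2))) < e"
              by (simp add: dist_real_def)
          qed
        qed
      qed
    qed
  qed (use t in auto)
  from has_integral_neg[OF this] show ?thesis by simp
qed

end

section \<open>The equation on the spine\<close>

lemma tooth_real: "tooth (ereal r) = {0..r}"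
  by (auto simp: tooth_def)

lemma tooth_infinity: "tooth \<infinity> = {0..}"
  by (auto simp: tooth_def)

lemma length_cases:
  assumes "0 < (h :: ereal)"
  obtains (bounded) r where "h = ereal r" "0 < r" | (unbounded) "h = \<infinity>"
  using assms by (cases h) auto

lemma closure_open_tooth:
  assumes "0 < h"
  shows "closure {y. 0 < y \<and> ereal y < h} = tooth h"
  using assms
proof (cases rule: length_cases)
  case (bounded r)
  then have "{y. 0 < y \<and> ereal y < h} = {0<..<r}" by auto
  with bounded show ?thesis by (simp add: tooth_real)
next
  case unbounded
  then have "{y. 0 < y \<and> ereal y < h} = {0<..}" by auto
  with unbounded show ?thesis by (simp add: tooth_infinity)
qed

text \<open>
  The differential equation and the initial condition of \<open>g\<close> are imposed on the open tooth only; this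
  carries them over to its ends.
\<close>
lemma eq_on_tooth:
  fixes f g :: "real \<Rightarrow> real"
  assumes "0 < h" "continuous_on (tooth h) f" "continuous_on (tooth h) g"
    and "\<And>y. 0 < y \<Longrightarrow> ereal y < h \<Longrightarrow> f y = g y" and "y \<in> tooth h"
  shows "f y = g y"
proof -
  have "f y - g y = 0"
    by (rule continuous_constant_on_closure[where S = "{y. 0 < y \<and> ereal y < h}" and f = "\<lambda>y. f y - g y"])
      (use assms in \<open>auto simp: closure_open_tooth intro!: continuous_intros\<close>)
  then show ?thesis by simp
qed

lemma bounded_classical_continuous:
  assumes "bounded_classical h w"
  shows "continuous_on (tooth h \<times> {0..}) (\<lambda>(y, s). w x y s)"
proof -
  have "continuous_on (UNIV \<times> tooth h \<times> {0..}) (\<lambda>(x, y, s). w x y s)"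
    using assms by (simp add: bounded_classical_def)
  from continuous_on_compose2[OF this, of "tooth h \<times> {0..}" "\<lambda>(y, s). (x, y, s)"]
  show ?thesis by (force simp: split_beta intro!: continuous_intros)
qed

lemma bounded_classical_bound:
  assumes "bounded_classical h w"
  obtains B where "\<And>x y s. y \<in> tooth h \<Longrightarrow> 0 \<le> s \<Longrightarrow> \<bar>w x y s\<bar> \<le> B"
proof -
  obtain B where B: "\<And>z. z \<in> (\<lambda>(x, y, t). w x y t) ` (UNIV \<times> tooth h \<times> {0..}) \<Longrightarrow> norm z \<le> B"
    using assms unfolding bounded_classical_def bounded_iff by blast
  have "\<bar>w x y s\<bar> \<le> B" if "y \<in> tooth h" "0 \<le> s" for x y s
    using B[OF image_eqI[of _ _ "(x, y, s)"]] that by simp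
  then show thesis by (rule that)
qed

text \<open>
  At the ends of the tooth the heat equation follows by continuity of \<open>dt w\<close> and \<open>dyy h w\<close>. At \<open>y = 0\<close>
  this is what expresses \<open>\<partial>\<^sub>t v\<close> through \<open>dyy h u\<close>.
\<close>
lemma bounded_classical_heat:
  assumes h: "0 < h" and w: "bounded_classical h w"
    and heat: "\<And>y t. t > 0 \<Longrightarrow> 0 < y \<Longrightarrow> ereal y < h \<Longrightarrow> dt w x y t - 1/2 * dyy h w x y t = 0"
    and y: "y \<in> tooth h" and s: "0 < s"
  shows "((\<lambda>s. w x y s) has_real_derivative dt w x y s) (at s)"
    and "dt w x y s = dyy h w x y s / 2"
    and "((\<lambda>y. w x y s) has_real_derivative dy h w x y s) (at y within tooth h)"
    and "((\<lambda>y. dy h w x y s) has_real_derivative dyy h w x y s) (at y within tooth h)"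
proof -
  have d: "(\<lambda>s. w x y s) differentiable at s"
    "(\<lambda>y. w x y s) differentiable (at y within tooth h)"
    "(\<lambda>y. dy h w x y s) differentiable (at y within tooth h)"
    using w y s unfolding bounded_classical_def by blast+
  show "((\<lambda>s. w x y s) has_real_derivative dt w x y s) (at s)"
    using d(1) by (simp add: dt_def DERIV_deriv_iff_real_differentiable)
  show "((\<lambda>y. w x y s) has_real_derivative dy h w x y s) (at y within tooth h)"
    using d(2) by (simp add: dy_def has_real_derivative_iff_has_vector_derivative vector_derivative_works)
  show "((\<lambda>y. dy h w x y s) has_real_derivative dyy h w x y s) (at y within tooth h)"
    using d(3) unfolding dyy_def
    by (simp add: dy_def[of h "dy h w"] has_real_derivative_iff_has_vector_derivative vector_derivative_works)
  have c: "continuous_on (tooth h \<times> {0<..}) (\<lambda>(y, t). dt w x y t)"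
    "continuous_on (tooth h \<times> {0<..}) (\<lambda>(y, t). dyy h w x y t)"
    using w unfolding bounded_classical_def by blast+
  have "continuous_on (tooth h) (\<lambda>y. dt w x y s)" "continuous_on (tooth h) (\<lambda>y. dyy h w x y s)"
  proof -
    have p: "continuous_on (tooth h) (\<lambda>y. (y, s))" "(\<lambda>y. (y, s)) ` tooth h \<subseteq> tooth h \<times> {0<..}"
      using s by (auto intro!: continuous_intros)
    show "continuous_on (tooth h) (\<lambda>y. dt w x y s)" "continuous_on (tooth h) (\<lambda>y. dyy h w x y s)"
      using continuous_on_compose2[OF c(1) p] continuous_on_compose2[OF c(2) p] by simp_all
  qed
  note c_s = this
  show "dt w x y s = dyy h w x y s / 2"
    by (rule eq_on_tooth[OF h, where g = "\<lambda>y. dyy h w x y s / 2"])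
      (use c_s heat[OF s] y in \<open>auto intro!: continuous_intros\<close>)
qed

lemma solution_difference_heat_flow:
  assumes h: "0 < h" and u0: "continuous_on (UNIV \<times> tooth h) (\<lambda>(x, y). u0 x y)"
    and u: "comb_solution h \<alpha> u0 u" and g: "tooth_solution h u0 g"
  shows "\<exists>M. heat_flow (tooth h) (\<lambda>y s. u x y s - g x y s - u0 x 0)
    (\<lambda>y s. dy h u x y s - dy h g x y s) (\<lambda>y s. dyy h u x y s - dyy h g x y s) M"
proof -
  have cu: "bounded_classical h u" and cg: "bounded_classical h g"
    using u g by (simp_all add: comb_solution_def tooth_solution_def)
  have hu: "dt u x y t - 1/2 * dyy h u x y t = 0" and hg: "dt g x y t - 1/2 * dyy h g x y t = 0"
    if "t > 0" "0 < y" "ereal y < h" for y t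
    using u g that by (auto simp: comb_solution_def tooth_solution_def)
  have zero: "0 \<in> tooth h" using h by (simp add: tooth_def zero_ereal_def[symmetric])
  have u_init: "u x y 0 = u0 x y" if "y \<in> tooth h" for x y
    using u that by (simp add: comb_solution_def)
  obtain Bu where "\<And>z y s. y \<in> tooth h \<Longrightarrow> 0 \<le> s \<Longrightarrow> \<bar>u z y s\<bar> \<le> Bu"
    by (rule bounded_classical_bound[OF cu]) (rule that)
  note Bu = this[where z = x]
  obtain Bg where "\<And>z y s. y \<in> tooth h \<Longrightarrow> 0 \<le> s \<Longrightarrow> \<bar>g z y s\<bar> \<le> Bg"
    by (rule bounded_classical_bound[OF cg]) (rule that)
  note Bg = this[where z = x]
  have g_init: "g x y 0 = u0 x y - u0 x 0" if y: "y \<in> tooth h" for y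
  proof (rule eq_on_tooth[OF h, where g = "\<lambda>y. u0 x y - u0 x 0"])
    have "continuous_on (tooth h) (\<lambda>y. case (y, 0::real) of (y, s) \<Rightarrow> g x y s)"
      by (rule continuous_on_compose2[OF bounded_classical_continuous[OF cg]])
        (auto intro!: continuous_intros)
    then show "continuous_on (tooth h) (\<lambda>y. g x y 0)" by simp
    have "continuous_on (tooth h) (\<lambda>y. case (x, y) of (x, y) \<Rightarrow> u0 x y)"
      by (rule continuous_on_compose2[OF u0]) (auto intro!: continuous_intros)
    then show "continuous_on (tooth h) (\<lambda>y. u0 x y - u0 x 0)"
      by (intro continuous_intros) simp
    show "g x y 0 = u0 x y - u0 x 0" if "0 < y" "ereal y < h" for y
      using g that by (simp add: tooth_solution_def)
  qed (rule y)
  have "heat_flow (tooth h) (\<lambda>y s. u x y s - g x y s - u0 x 0)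
    (\<lambda>y s. dy h u x y s - dy h g x y s) (\<lambda>y s. dyy h u x y s - dyy h g x y s) (2 * Bu + Bg)"
  proof
    fix y s :: real assume y: "y \<in> tooth h"
    show "u x y 0 - g x y 0 - u0 x 0 = 0" using y by (simp add: u_init g_init)
    show "\<bar>u x y s - g x y s - u0 x 0\<bar> \<le> 2 * Bu + Bg" if "0 \<le> s"
      using Bu[OF y that] Bg[OF y that] Bu[OF zero, of 0] u_init[OF zero, of x] by linarith
    assume s: "0 < s"
    show "((\<lambda>s. u x y s - g x y s - u0 x 0) has_real_derivative (dyy h u x y s - dyy h g x y s) / 2) (at s)"
      using DERIV_diff[OF DERIV_diff[OF bounded_classical_heat(1)[OF h cu hu y s] bounded_classical_heat(1)[OF h cg hg y s]] DERIV_const[of "u0 x 0"]]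
        bounded_classical_heat(2)[OF h cu hu y s] bounded_classical_heat(2)[OF h cg hg y s]
      by (simp add: diff_divide_distrib)
    show "((\<lambda>y. u x y s - g x y s - u0 x 0) has_real_derivative dy h u x y s - dy h g x y s) (at y within tooth h)"
      using DERIV_diff[OF DERIV_diff[OF bounded_classical_heat(3)[OF h cu hu y s] bounded_classical_heat(3)[OF h cg hg y s]] DERIV_const[of "u0 x 0"]] by simp
    show "((\<lambda>y. dy h u x y s - dy h g x y s) has_real_derivative dyy h u x y s - dyy h g x y s) (at y within tooth h)"
      by (intro DERIV_diff bounded_classical_heat(4)[OF h cu hu y s] bounded_classical_heat(4)[OF h cg hg y s])
  next
    have "continuous_on (tooth h \<times> {0..}) (\<lambda>(y, s). w x y s)"
      "continuous_on (tooth h \<times> {0<..}) (\<lambda>(y, s). dy h w x y s)"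
      "continuous_on (tooth h \<times> {0<..}) (\<lambda>(y, s). dyy h w x y s)" if "bounded_classical h w" for w
      using that bounded_classical_continuous[OF that] unfolding bounded_classical_def by blast+
    note c = this[unfolded split_beta]
    show "continuous_on (tooth h \<times> {0..}) (\<lambda>(y, s). u x y s - g x y s - u0 x 0)"
      unfolding split_beta by (intro continuous_on_diff c cu cg continuous_on_const)
    show "continuous_on (tooth h \<times> {0<..}) (\<lambda>(y, s). dy h u x y s - dy h g x y s)"
      unfolding split_beta by (intro continuous_on_diff c cu cg)
    show "continuous_on (tooth h \<times> {0<..}) (\<lambda>(y, s). dyy h u x y s - dyy h g x y s)"
      unfolding split_beta by (intro continuous_on_diff c cu cg)
  qed (rule zero)
  then show ?thesis by blast
qed

lemma caputo_kernel_bounded_tooth: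
  "caputo_kernel (ereal r) \<tau> = 2 / r * (\<Sum>k. exp (- ((mode r k)\<^sup>2 / 2 * \<tau>)))"
  by (simp add: caputo_kernel_def mode_def power_divide power_mult_distrib)

lemma caputo_kernel_unbounded_tooth:
  "caputo_kernel \<infinity> \<tau> = gauss_kernel 0 \<tau>"
  by (simp add: caputo_kernel_def gauss_kernel_def)

text \<open>
  The map from the trace of \<open>\<phi>\<close> on the spine to its flux into the tooth is minus the generalized
  Caputo derivative.
\<close>
lemma flux_identity:
  assumes h: "0 < h" and flow: "heat_flow (tooth h) \<phi> \<phi>y \<phi>yy M" and t: "0 < t"
    and no_flux: "\<And>s. h \<noteq> \<infinity> \<Longrightarrow> 0 < s \<Longrightarrow> \<phi>y (real_of_ereal h) s = 0"
  shows "((\<lambda>s. caputo_kernel h (t - s) * (\<phi>yy 0 s / 2)) has_integral - \<phi>y 0 t) {0..t}"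
proof (rule length_cases[OF h])
  fix r assume r: "h = ereal r" "0 < r"
  have flow_r: "heat_flow {0..r} \<phi> \<phi>y \<phi>yy M"
    using flow unfolding r(1) tooth_real .
  have "\<phi>y r s = 0" if "0 < s" for s
    using no_flux[of s] that by (simp add: r(1))
  from heat_flow.flux_identity_bounded_tooth[OF flow_r r(2) refl this t]
  show ?thesis unfolding r(1) caputo_kernel_bounded_tooth .
next
  assume r: "h = \<infinity>"
  have "heat_flow {0..} \<phi> \<phi>y \<phi>yy M"
    using flow unfolding r tooth_infinity .
  from heat_flow.flux_identity_unbounded_tooth[OF this refl t]
  show ?thesis unfolding r caputo_kernel_unbounded_tooth .
qed

theorem proposition1p4:
  fixes h0 :: ereal and \<alpha> :: real
    and u0 :: "real \<Rightarrow> real \<Rightarrow> real"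
    and u g :: "real \<Rightarrow> real \<Rightarrow> real \<Rightarrow> real"
    and v f :: "real \<Rightarrow> real \<Rightarrow> real"
  assumes "0 < h0" and "0 < \<alpha>"
    and "continuous_on (UNIV \<times> tooth h0) (\<lambda>(x, y). u0 x y)"
    and "bounded ((\<lambda>(x, y). u0 x y) ` (UNIV \<times> tooth h0))"
    and "comb_solution h0 \<alpha> u0 u"
    and "\<And>x t. t \<ge> 0 \<Longrightarrow> v x t = u x 0 t"
    and "tooth_solution h0 u0 g"
    and "\<And>x t. t > 0 \<Longrightarrow> f x t = dy h0 g x 0 t"
  shows "continuous_on (UNIV \<times> {0..}) (\<lambda>(x, t). v x t) \<and>
    (\<forall>x. v x 0 = u0 x 0) \<and>
    (\<forall>x t. t > 0 \<longrightarrow>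
       (\<lambda>s. v x s) differentiable at t \<and>
       twice_differentiable_at (\<lambda>z. v z t) x \<and>
       caputo_integrand h0 v x t integrable_on {0..t} \<and>
       deriv (\<lambda>s. v x s) t + \<alpha> / 2 * caputo_deriv h0 v x t
         - 1/2 * deriv (deriv (\<lambda>z. v z t)) x = \<alpha> / 2 * f x t)"
proof (intro conjI allI impI)
  note h = \<open>0 < h0\<close> and u = \<open>comb_solution h0 \<alpha> u0 u\<close> and g = \<open>tooth_solution h0 u0 g\<close>
  have zero: "0 \<in> tooth h0" using h by (simp add: tooth_def zero_ereal_def[symmetric])
  have cu: "bounded_classical h0 u" and cg: "bounded_classical h0 g"
    using u g by (simp_all add: comb_solution_def tooth_solution_def)
  have hu: "dt u x y t - 1/2 * dyy h0 u x y t = 0" and hg: "dt g x y t - 1/2 * dyy h0 g x y t = 0"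
    if "t > 0" "0 < y" "ereal y < h0" for x y t
    using u g that by (auto simp: comb_solution_def tooth_solution_def)
  show "continuous_on (UNIV \<times> {0..}) (\<lambda>(x, t). v x t)"
  proof (rule continuous_on_eq)
    have "continuous_on (UNIV \<times> tooth h0 \<times> {0..}) (\<lambda>(x, y, t). u x y t)"
      using cu by (simp add: bounded_classical_def)
    from continuous_on_compose2[OF this, of "UNIV \<times> {0..}" "\<lambda>(x, t). (x, 0, t)"] zero
    show "continuous_on (UNIV \<times> {0..}) (\<lambda>(x, t). u x 0 t)"
      by (force simp: split_beta intro!: continuous_intros)
  qed (use assms(6) in auto)
  show "v x 0 = u0 x 0" for x
    using u zero assms(6)[of 0 x] by (simp add: comb_solution_def)
  fix x t :: real assume t: "0 < t"
  have v_deriv: "((\<lambda>s. v x s) has_real_derivative dt u x 0 s) (at s)" if s: "0 < s" for s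
  proof (rule has_field_derivative_transform_within_open[where S = "{0<..}"])
    show "((\<lambda>s. u x 0 s) has_real_derivative dt u x 0 s) (at s)"
      by (rule bounded_classical_heat(1)[OF h cu hu zero s])
  qed (use s assms(6) in auto)
  show "(\<lambda>s. v x s) differentiable at t"
    using v_deriv[OF t] real_differentiable_def by blast
  have vx: "(\<lambda>z. v z t) = (\<lambda>z. u z 0 t)"
    using assms(6) t by auto
  show "twice_differentiable_at (\<lambda>z. v z t) x"
    unfolding vx using u t by (simp add: comb_solution_def)
  obtain M where flow: "heat_flow (tooth h0) (\<lambda>y s. u x y s - g x y s - u0 x 0)
      (\<lambda>y s. dy h0 u x y s - dy h0 g x y s) (\<lambda>y s. dyy h0 u x y s - dyy h0 g x y s) M"
    using solution_difference_heat_flow[OF h assms(3) u g] by blast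
  have flux: "((\<lambda>s. caputo_kernel h0 (t - s) * ((dyy h0 u x 0 s - dyy h0 g x 0 s) / 2)) has_integral
      - (dy h0 u x 0 t - dy h0 g x 0 t)) {0..t}"
    by (rule flux_identity[OF h flow t]) (use u g in \<open>auto simp: comb_solution_def tooth_solution_def\<close>)
  have integrand: "caputo_integrand h0 v x t s = caputo_kernel h0 (t - s) * ((dyy h0 u x 0 s - dyy h0 g x 0 s) / 2)"
    if s: "s \<in> {0..t} - {0}" for s
  proof -
    have s: "0 < s" using s by auto
    have "((\<lambda>s. 0) has_real_derivative dt g x 0 s) (at s)"
    proof (rule has_field_derivative_transform_within_open[where S = "{0<..}"])
      show "((\<lambda>s. g x 0 s) has_real_derivative dt g x 0 s) (at s)"
        by (rule bounded_classical_heat(1)[OF h cg hg zero s])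
    qed (use s g in \<open>auto simp: tooth_solution_def\<close>)
    then have "dt g x 0 s = 0"
      using DERIV_unique DERIV_const by blast
    then have "dyy h0 g x 0 s = 0"
      using bounded_classical_heat(2)[OF h cg hg zero s] by simp
    moreover have "deriv (\<lambda>r. v x r) s = dyy h0 u x 0 s / 2"
      using DERIV_imp_deriv[OF v_deriv[OF s]] bounded_classical_heat(2)[OF h cu hu zero s] by simp
    ultimately show ?thesis by (simp add: caputo_integrand_def)
  qed
  have caputo: "(caputo_integrand h0 v x t has_integral - (dy h0 u x 0 t - dy h0 g x 0 t)) {0..t}"
    by (rule has_integral_spike_finite[where S = "{0}", OF _ _ flux]) (use integrand in auto)
  then show "caputo_integrand h0 v x t integrable_on {0..t}"
    by (rule has_integral_integrable)
  have "\<alpha> * dy h0 u x 0 t + deriv (deriv (\<lambda>z. u z 0 t)) x = dyy h0 u x 0 t"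
    using u t by (simp add: comb_solution_def)
  then have vxx: "deriv (deriv (\<lambda>z. v z t)) x = dyy h0 u x 0 t - \<alpha> * dy h0 u x 0 t"
    unfolding vx by linarith
  have vt: "deriv (\<lambda>s. v x s) t = dyy h0 u x 0 t / 2"
    using DERIV_imp_deriv[OF v_deriv[OF t]] bounded_classical_heat(2)[OF h cu hu zero t] by simp
  have cap: "caputo_deriv h0 v x t = dy h0 g x 0 t - dy h0 u x 0 t"
    using caputo by (simp add: caputo_deriv_def integral_unique)
  have "a / 2 + \<alpha> / 2 * (p - q) - 1/2 * (a - \<alpha> * q) = \<alpha> / 2 * p" for a p q :: real
    by (simp add: field_simps)
  then show "deriv (\<lambda>s. v x s) t + \<alpha> / 2 * caputo_deriv h0 v x t
      - 1/2 * deriv (deriv (\<lambda>z. v z t)) x = \<alpha> / 2 * f x t"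
    by (simp only: vxx vt cap assms(8)[OF t])
qed

end
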